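(* Let $m,n>-1/2$ and $0\le|\beta_i|<\alpha_i$, $i=1,2$. Let $X\sim\mathrm{VG}(m,\alpha_1,\beta_1,0)$ and $Y\sim\mathrm{VG}(n,\alpha_2,\beta_2,0)$ be independent, and let $f_Z$ be the probability density function of $Z=X/Y$. 1. Suppose $n>0$. Then, as $|z|\to\infty$, $$f_Z(z)\sim\frac{\gamma_1^{2m+1}\gamma_2^{2n+1}}{\pi\alpha_1^{2m+2}\alpha_2^{2n}}\,\frac{\Gamma(m+1)\Gamma(n)z^{-2}}{\Gamma(m+1/2)\Gamma(n+1/2)}\,{}_2F_1\bigg(1,m+1;\frac12;\frac{\beta_1^2}{\alpha_1^2}\bigg).$$ 2. Suppose $n=0$. Then, as $|z|\to\infty$, $$f_Z(z)\sim\frac{2\gamma_1^{2m+1}\gamma_2}{\pi^{3/2}\alpha_1^{2m+2}}\,\frac{\Gamma(m+1)z^{-2}\log|z|}{\Gamma(m+1/2)}\,{}_2F_1\bigg(1,m+1;\frac12;\frac{\beta_1^2}{\alpha_1^2}\bigg).$$ 3. Suppose $-1/2<n<0$. Then, as $|z|\to\infty$, $$f_Z(z)\sim\frac{\gamma_1^{2m+1}\gamma_2^{2n+1}}{\alpha_1^{2m+2n+2}\sin(-n\pi)}\,\frac{\Gamma(m+n+1)|z|^{-2-2n}}{\Gamma(m+1/2)\Gamma(n+1/2)}\,{}_2F_1\bigg(n+1,m+n+1;\frac12;\frac{\beta_1^2}{\alpha_1^2}\bigg).$$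
   Context: For $m>-1/2$ and $0\le|\beta|<\alpha$, a random variable $X$ has the variance-gamma distribution $\mathrm{VG}(m,\alpha,\beta,0)$ if it has probability density function $$f_X(x)=\frac{\gamma^{2m+1}}{\sqrt{\pi}(2\alpha)^m\Gamma(m+1/2)}\,\mathrm{e}^{\beta x}|x|^mK_m(\alpha|x|),\quad x\in\mathbb{R},\qquad \gamma^2=\alpha^2-\beta^2,\ \gamma>0,$$ where $K_m(x)=\int_0^\infty \mathrm{e}^{-x\cosh t}\cosh(mt)\,\mathrm{d}t$, $x>0$, is the modified Bessel function of the second kind. Notation: $\gamma_i=\sqrt{\alpha_i^2-\beta_i^2}$, $i=1,2$. ${}_2F_1(a,b;c;x)=\sum_{k=0}^\infty\frac{(a)_k(b)_k}{(c)_k}\frac{x^k}{k!}$ for $|x|<1$, with $(u)_k=u(u+1)\cdots(u+k-1)$. The density of the ratio is the version $f_Z(z)=\int_{-\infty}^\infty|y|f_X(yz)f_Y(y)\,\mathrm{d}y$. The relation $f(z)\sim g(z)$ means $f(z)/g(z)\to1$ in the stated limit. *)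

theory Defs
  imports "HOL-Probability.Probability" "HOL-Library.Landau_Symbols"
begin

text \<open>At \<open>x = 0\<close> the integrand is not integrable and the Bochner integral returns the
  default value 0; only \<open>x > 0\<close> is meaningful.\<close>

definition bessel_K :: "real \<Rightarrow> real \<Rightarrow> real" where
  "bessel_K m x = (LINT t:{0<..}|lborel. exp (- x * cosh t) * cosh (m * t))"

text \<open>The Gauss series; meaningful for \<open>\<bar>x\<bar> < 1\<close>.\<close>

definition hyp2F1 :: "real \<Rightarrow> real \<Rightarrow> real \<Rightarrow> real \<Rightarrow> real" where
  "hyp2F1 a b c x =
     (\<Sum>k. pochhammer a k * pochhammer b k / pochhammer c k * (x ^ k / fact k))"

definition vg_gamma :: "real \<Rightarrow> real \<Rightarrow> real" where
  "vg_gamma \<alpha> \<beta> = sqrt (\<alpha>\<^sup>2 - \<beta>\<^sup>2)"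

text \<open>Density of \<open>VG(m, \<alpha>, \<beta>, 0)\<close>, for \<open>m > -1/2\<close> and \<open>\<bar>\<beta>\<bar> < \<alpha>\<close>. Its value at the
  single point \<open>x = 0\<close> is 0 by the conventions of \<open>powr\<close> and of the integral, which need not
  be the limit of the density there.\<close>

definition vg_density :: "real \<Rightarrow> real \<Rightarrow> real \<Rightarrow> real \<Rightarrow> real" where
  "vg_density m \<alpha> \<beta> x =
     vg_gamma \<alpha> \<beta> powr (2 * m + 1) / (sqrt pi * (2 * \<alpha>) powr m * Gamma (m + 1/2))
       * exp (\<beta> * x) * \<bar>x\<bar> powr m * bessel_K m (\<alpha> * \<bar>x\<bar>)"

definition VG_distributed ::
  "'a measure \<Rightarrow> ('a \<Rightarrow> real) \<Rightarrow> real \<Rightarrow> real \<Rightarrow> real \<Rightarrow> bool" where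
  "VG_distributed M X m \<alpha> \<beta> \<longleftrightarrow>
     distributed M lborel X (\<lambda>x. ennreal (vg_density m \<alpha> \<beta> x))"

text \<open>A density is determined only up to null sets, whereas its pointwise asymptotics are not;
  this is the version for the quotient of independent variables with densities \<open>f\<close> and \<open>g\<close>.\<close>

definition ratio_density :: "(real \<Rightarrow> real) \<Rightarrow> (real \<Rightarrow> real) \<Rightarrow> real \<Rightarrow> real" where
  "ratio_density f g z = (LINT y|lborel. \<bar>y\<bar> * f (y * z) * g y)"

end

(* Substituting u = y z gives z^2 f_Z(z) = \<integral> |u| f_X(u) f_Y(u/z) du, so the asymptotics of f_Z
   at infinity are those of f_Y at 0, passed under the integral by dominated convergence; the
   limit is an absolute moment of X. Everything rests on the logarithmic form
   2 x^m K_m(x) = \<integral> exp (m t - e^t/2 - x^2 e^(-t)/2) dt over the whole line: at x = 0 it is a Gamma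
   integral, which gives the behaviour of K_m at 0, and after the linear change of variables
   p = t, q = 2 log x - t it splits the Mellin transform of K_m into a product of two Gamma
   integrals. Expanding cosh (\<beta> u) then turns the moments into a hypergeometric series.
   For n < 0 one has K_n = K_(-n), and for n = 0 the bounds |K_0(x) + ln x| \<le> 2 on (0,1] suffice. The case z \<rightarrow> -\<infinity>
   reduces to z \<rightarrow> \<infinity> by \<beta> \<mapsto> -\<beta> in the density of X. *)

theory Submission
  imports Defs "HOL-Real_Asymp.Real_Asymp"
begin

section \<open>Integrals in logarithmic coordinates\<close>

text \<open>Most integrals are computed with values in \<open>ennreal\<close>: Tonelli and termwise
  summation then ask for no integrability, which is read off afterwards from the finiteness of the
  value. The obstacle to dominated convergence is that \<open>u / z\<close> runs over the whole line
  for every \<open>z\<close>, so knowing the density of Y near 0 is not enough. What is needed is a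
  global bound: for n different from 0 the function x^|n| K_|n|(x) never exceeds its limit at the
  origin, and for n = 0 a logarithmic bound holds for every x > 0. The exponential factor of Y is
  absorbed into that of X, which leaves room because |\<beta>1| < \<alpha>1 is strict. The
  singularity of the density of Y at 0 has order r = n - |n|. The condition n > -1/2 gives r > -1,
  so the weight |u| of the quotient density compensates it. Convergence to a constant yields an
  asymptotic equivalence only if the constant is nonzero, hence the positivity of the hypergeometric
  series.\<close>

lemma nn_integral_lborel_fold:
  fixes f :: "real \<Rightarrow> ennreal"
  assumes [measurable]: "f \<in> borel_measurable borel"
  shows "(\<integral>\<^sup>+x. f x \<partial>lborel) = (\<integral>\<^sup>+x. (f x + f (- x)) * indicator {0<..} x \<partial>lborel)"
proof -
  have "(\<integral>\<^sup>+x. f x \<partial>lborel)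
      = (\<integral>\<^sup>+x. f x * indicator {0<..} x + f x * indicator {..<0} x \<partial>lborel)"
    by (intro nn_integral_cong_AE AE_I[of _ _ "{0}"]) (auto simp: indicator_def)
  also have "\<dots> = (\<integral>\<^sup>+x. f x * indicator {0<..} x \<partial>lborel)
      + (\<integral>\<^sup>+x. f x * indicator {..<0} x \<partial>lborel)"
    by (intro nn_integral_add) auto
  also have "(\<integral>\<^sup>+x. f x * indicator {..<0} x \<partial>lborel)
      = (\<integral>\<^sup>+x. f (- x) * indicator {0<..} x \<partial>lborel)"
    by (subst nn_integral_real_affine[of _ "-1" 0])
       (auto simp: indicator_def intro!: nn_integral_cong)
  also have "(\<integral>\<^sup>+x. f x * indicator {0<..} x \<partial>lborel) + \<dots>
      = (\<integral>\<^sup>+x. f x * indicator {0<..} x + f (- x) * indicator {0<..} x \<partial>lborel)"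
    by (intro nn_integral_add[symmetric]) auto
  finally show ?thesis by (simp add: algebra_simps)
qed

text \<open>The substitution rule is applied on the compact intervals [-k, k], and monotone
  convergence on both sides extends it to the half line and the whole line.\<close>

lemma nn_integral_exp_substitution:
  fixes f :: "real \<Rightarrow> real"
  assumes [measurable]: "f \<in> borel_measurable borel"
  shows "(\<integral>\<^sup>+x. ennreal (f x) * indicator {0<..} x \<partial>lborel)
       = (\<integral>\<^sup>+t. ennreal (f (exp t) * exp t) \<partial>lborel)"
proof -
  define F where "F = (\<lambda>k x. ennreal (f x) * indicator {exp (- real k)..exp (real k)} x)"
  define G where "G = (\<lambda>k t. ennreal (f (exp t) * exp t) * indicator {- real k..real k} t)"
  have eq: "(\<integral>\<^sup>+x. F k x \<partial>lborel) = (\<integral>\<^sup>+t. G k t \<partial>lborel)" for k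
  proof -
    have "(\<integral>\<^sup>+x. f x * indicator {exp (- real k)..exp (real k)} x \<partial>lborel)
        = (\<integral>\<^sup>+t. f (exp t) * exp t * indicator {- real k..real k} t \<partial>lborel)"
      by (rule nn_integral_substitution)
         (auto intro!: derivative_eq_intros continuous_intros simp: set_borel_measurable_def)
    then show ?thesis
      unfolding F_def G_def
      by (metis (mono_tags, lifting) ennreal_indicator ennreal_mult'' indicator_pos_le nn_integral_cong)
  qed
  have "(\<lambda>k. \<integral>\<^sup>+x. F k x \<partial>lborel) \<longlonglongrightarrow> (\<integral>\<^sup>+x. ennreal (f x) * indicator {0<..} x \<partial>lborel)"
  proof (rule nn_integral_LIMSEQ)
    show "incseq F"
      by (auto simp: F_def incseq_def le_fun_def split: split_indicator)
         (meson exp_le_cancel_iff neg_le_iff_le of_nat_le_iff order_trans)+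
    show "F k \<in> borel_measurable lborel" for k by (simp add: F_def)
    show "(\<lambda>k. F k x) \<longlonglongrightarrow> ennreal (f x) * indicator {0<..} x" for x
    proof (cases "x > 0")
      case True
      obtain N where N: "\<bar>ln x\<bar> \<le> real N" using real_arch_simple by blast
      have "\<forall>\<^sub>F k in sequentially. F k x = ennreal (f x) * indicator {0<..} x"
        using eventually_ge_at_top[of N]
      proof eventually_elim
        case (elim k)
        then have "\<bar>ln x\<bar> \<le> real k" using N by linarith
        then have "x \<in> {exp (- real k)..exp (real k)}" using True
          by (auto simp: abs_le_iff ln_ge_iff[symmetric]) (metis exp_le_cancel_iff exp_ln)
        then show ?case using True by (simp add: F_def)
      qed
      then show ?thesis by (rule tendsto_eventually)
    next
      case False
      then have "x \<notin> {exp (- real k)..exp (real k)}" for k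
        by (metis atLeastAtMost_iff exp_gt_zero less_le_trans)
      then show ?thesis using False by (simp add: F_def)
    qed
  qed
  moreover have "(\<lambda>k. \<integral>\<^sup>+x. G k x \<partial>lborel) \<longlonglongrightarrow> (\<integral>\<^sup>+t. ennreal (f (exp t) * exp t) \<partial>lborel)"
  proof (rule nn_integral_LIMSEQ)
    show "incseq G"
      by (auto simp: G_def incseq_def le_fun_def split: split_indicator)
    show "G k \<in> borel_measurable lborel" for k by (simp add: G_def)
    show "(\<lambda>k. G k t) \<longlonglongrightarrow> ennreal (f (exp t) * exp t)" for t
    proof -
      obtain N where N: "\<bar>t\<bar> \<le> real N" using real_arch_simple by blast
      have "\<forall>\<^sub>F k in sequentially. G k t = ennreal (f (exp t) * exp t)"
        using eventually_ge_at_top[of N]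
        by eventually_elim (use N in \<open>auto simp: G_def indicator_def\<close>)
      then show ?thesis by (rule tendsto_eventually)
    qed
  qed
  ultimately show ?thesis unfolding eq by (rule LIMSEQ_unique)
qed

lemma nn_integral_shift:
  fixes f :: "real \<Rightarrow> ennreal"
  assumes [measurable]: "f \<in> borel_measurable borel"
  shows "(\<integral>\<^sup>+t. f t \<partial>lborel) = (\<integral>\<^sup>+t. f (t - c) \<partial>lborel)"
  by (subst nn_integral_real_affine[of f 1 "- c"]) simp_all

text \<open>Euler's integral under \<open>x = exp t\<close>. The shift by \<open>ln 2\<close>
  produces the \<open>exp t / 2\<close> that stems from the cosh, at the price of the factor
  \<open>2 powr a\<close>.\<close>

lemma nn_integral_Gamma_exp:
  fixes a :: real
  assumes "a > 0"
  shows "(\<integral>\<^sup>+t. ennreal (exp (a * t - exp t / 2)) \<partial>lborel) = ennreal (2 powr a * Gamma a)"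
proof -
  have exp_ln_2: "exp (t - ln 2) = exp t / 2" for t :: real
    by (simp add: exp_diff)
  have "ennreal (Gamma a) = (\<integral>\<^sup>+t. ennreal (t powr (a - 1) / exp t) * indicator {0<..} t \<partial>lborel)"
    unfolding Gamma_conv_nn_integral_real[OF assms]
    by (intro nn_integral_cong_AE AE_I[of _ _ "{0}"]) (auto simp: indicator_def)
  also have "\<dots> = (\<integral>\<^sup>+t. ennreal (exp t powr (a - 1) / exp (exp t) * exp t) \<partial>lborel)"
    by (rule nn_integral_exp_substitution) auto
  also have "\<dots> = (\<integral>\<^sup>+t. ennreal (exp (a * t - exp t)) \<partial>lborel)"
    by (intro nn_integral_cong)
       (auto simp: powr_def algebra_simps exp_add[symmetric] exp_diff[symmetric])
  also have "\<dots> = (\<integral>\<^sup>+t. ennreal (exp (a * (t - ln 2) - exp (t - ln 2))) \<partial>lborel)"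
    by (rule nn_integral_shift) simp
  also have "\<dots> = (\<integral>\<^sup>+t. ennreal (2 powr (- a)) * ennreal (exp (a * t - exp t / 2)) \<partial>lborel)"
    using exp_ln_2 by (intro nn_integral_cong)
       (simp add: powr_def ennreal_mult'[symmetric] exp_add[symmetric] algebra_simps)
  also have "\<dots> = ennreal (2 powr (- a)) * (\<integral>\<^sup>+t. ennreal (exp (a * t - exp t / 2)) \<partial>lborel)"
    by (rule nn_integral_cmult) simp
  finally have "ennreal (2 powr a) * ennreal (Gamma a)
      = (ennreal (2 powr a) * ennreal (2 powr (- a)))
        * (\<integral>\<^sup>+t. ennreal (exp (a * t - exp t / 2)) \<partial>lborel)"
    by (simp add: mult.assoc)
  also have "ennreal (2 powr a) * ennreal (2 powr (- a)) = 1"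
    by (simp add: ennreal_mult'[symmetric] powr_add[symmetric])
  finally show ?thesis by (simp add: ennreal_mult')
qed

text \<open>The shift by \<open>ln x\<close> moves all dependence on \<open>x\<close> into one of
  the two exponentials of the cosh, where it disappears as \<open>x\<close> tends to 0.\<close>

lemma mult_cosh_shift:
  fixes x t :: real
  assumes "x > 0"
  shows "x * cosh (t - ln x) = exp t / 2 + x\<^sup>2 * exp (- t) / 2"
  using assms by (simp add: cosh_field_def exp_diff exp_minus field_simps power2_eq_square)

lemma nn_integral_exp_cosh_shift:
  assumes "x > 0"
  shows "ennreal (x powr m) * (\<integral>\<^sup>+t. ennreal (exp (m * t - x * cosh t)) \<partial>lborel)
       = (\<integral>\<^sup>+t. ennreal (exp (m * t - exp t / 2 - x\<^sup>2 * exp (- t) / 2)) \<partial>lborel)"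
proof -
  have "(\<integral>\<^sup>+t. ennreal (exp (m * t - x * cosh t)) \<partial>lborel)
      = (\<integral>\<^sup>+t. ennreal (exp (m * (t - ln x) - x * cosh (t - ln x))) \<partial>lborel)"
    by (rule nn_integral_shift) (simp add: cosh_field_def)
  then have "ennreal (x powr m) * (\<integral>\<^sup>+t. ennreal (exp (m * t - x * cosh t)) \<partial>lborel)
      = (\<integral>\<^sup>+t. ennreal (x powr m) * ennreal (exp (m * (t - ln x) - x * cosh (t - ln x))) \<partial>lborel)"
    by (simp add: cosh_field_def nn_integral_cmult)
  also have "\<dots> = (\<integral>\<^sup>+t. ennreal (exp (m * t - exp t / 2 - x\<^sup>2 * exp (- t) / 2)) \<partial>lborel)"
    using assms unfolding mult_cosh_shift[OF assms]
    by (intro nn_integral_cong)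
       (simp add: powr_def ennreal_mult'[symmetric] exp_add[symmetric] algebra_simps)
  finally show ?thesis .
qed

section \<open>The Bessel function as an integral over the whole line\<close>

lemma bessel_K_minus: "bessel_K (- m) x = bessel_K m x"
  by (simp add: bessel_K_def)

lemma bessel_K_nonneg: "bessel_K m x \<ge> 0"
  unfolding bessel_K_def set_lebesgue_integral_def
  by (intro Bochner_Integration.integral_nonneg) (auto simp: indicator_def)

lemma borel_measurable_bessel_K [measurable]: "bessel_K m \<in> borel_measurable borel"
proof -
  have [measurable]: "cosh \<in> borel_measurable (borel :: real measure)"
    unfolding cosh_field_def[abs_def] by measurable
  show ?thesis
    unfolding bessel_K_def[abs_def] set_lebesgue_integral_def by measurable
qed

text \<open>Folding the line at 0 keeps the even part of \<open>exp (m * t)\<close> and gives twice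
  the defining integral. As that is a Bochner integral with a default value, its integrability has
  to be shown as well.\<close>

lemma nn_integral_bessel_K:
  assumes "x > 0"
  shows "(\<integral>\<^sup>+t. ennreal (exp (m * t - x * cosh t)) \<partial>lborel) = ennreal (2 * bessel_K m x)"
proof -
  have [measurable]: "cosh \<in> borel_measurable (borel :: real measure)"
    unfolding cosh_field_def[abs_def] by measurable
  have pointwise: "ennreal (exp (k * t - x * cosh t)) + ennreal (exp (k * - t - x * cosh (- t)))
      = 2 * ennreal (exp (- x * cosh t) * cosh (k * t))" for k t
  proof -
    have "exp (k * t - x * cosh t) + exp (k * - t - x * cosh (- t))
        = 2 * (exp (- x * cosh t) * cosh (k * t))"
      unfolding cosh_field_def[of "k * t"]
      by (simp add: distrib_left exp_add[symmetric] algebra_simps)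
    then show ?thesis
      by (simp add: ennreal_mult' flip: ennreal_plus ennreal_numeral)
  qed
  have fold: "(\<integral>\<^sup>+t. ennreal (exp (k * t - x * cosh t)) \<partial>lborel)
      = 2 * (\<integral>\<^sup>+t. ennreal (indicator {0<..} t *\<^sub>R (exp (- x * cosh t) * cosh (k * t))) \<partial>lborel)" for k
    by (subst nn_integral_lborel_fold, simp, unfold pointwise, subst nn_integral_cmult[symmetric])
       (auto intro!: nn_integral_cong simp: indicator_def)
  \<comment> \<open>The Gamma integral that bounds the logarithmic form converges only for a
    positive order. The order \<open>|m| + 1\<close> is positive for every \<open>m\<close>, and its
    cosh dominates \<open>cosh (m * t)\<close>.\<close>
  define n where "n = \<bar>m\<bar> + 1"
  have "ennreal (x powr n) * (\<integral>\<^sup>+t. ennreal (exp (n * t - x * cosh t)) \<partial>lborel)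
      \<le> (\<integral>\<^sup>+t. ennreal (exp (n * t - exp t / 2)) \<partial>lborel)"
    unfolding nn_integral_exp_cosh_shift[OF assms] by (intro nn_integral_mono) simp
  also have "\<dots> < top"
    by (subst nn_integral_Gamma_exp) (auto simp: n_def)
  finally have fin_n: "(\<integral>\<^sup>+t. ennreal (exp (n * t - x * cosh t)) \<partial>lborel) < top"
    using assms by (auto simp: ennreal_mult_less_top)
  have "integrable lborel (\<lambda>t. indicator {0<..} t *\<^sub>R (exp (- x * cosh t) * cosh (m * t)))"
  proof (rule integrableI_nonneg)
    have "cosh (m * t) \<le> cosh (n * t)" for t
    proof -
      have "\<bar>m * t\<bar> \<le> \<bar>n * t\<bar>" by (simp add: n_def abs_mult mult_right_mono)
      then have "cosh \<bar>m * t\<bar> \<le> cosh \<bar>n * t\<bar>" by (subst cosh_real_nonneg_le_iff) auto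
      then show ?thesis by simp
    qed
    then have "(\<integral>\<^sup>+t. ennreal (indicator {0<..} t *\<^sub>R (exp (- x * cosh t) * cosh (m * t))) \<partial>lborel)
        \<le> (\<integral>\<^sup>+t. ennreal (indicator {0<..} t *\<^sub>R (exp (- x * cosh t) * cosh (n * t))) \<partial>lborel)"
      by (intro nn_integral_mono ennreal_leI) (auto simp: indicator_def)
    also have "\<dots> < \<infinity>"
      using fin_n unfolding fold[of n] by (auto simp: ennreal_mult_less_top)
    finally show "(\<integral>\<^sup>+t. ennreal (indicator {0<..} t *\<^sub>R (exp (- x * cosh t) * cosh (m * t))) \<partial>lborel) < \<infinity>" .
  qed (auto simp: indicator_def)
  then have "(\<integral>\<^sup>+t. ennreal (indicator {0<..} t *\<^sub>R (exp (- x * cosh t) * cosh (m * t))) \<partial>lborel)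
      = ennreal (bessel_K m x)"
    unfolding bessel_K_def set_lebesgue_integral_def
    by (intro nn_integral_eq_integral) (auto simp: indicator_def)
  then show ?thesis
    unfolding fold by (simp add: ennreal_mult' flip: ennreal_numeral)
qed

lemma nn_integral_powr_bessel_K:
  assumes "x > 0"
  shows "(\<integral>\<^sup>+t. ennreal (exp (m * t - exp t / 2 - x\<^sup>2 * exp (- t) / 2)) \<partial>lborel)
       = ennreal (2 * (x powr m * bessel_K m x))"
  unfolding nn_integral_exp_cosh_shift[OF assms, symmetric] nn_integral_bessel_K[OF assms]
  by (simp add: ennreal_mult'[symmetric] mult_ac)

section \<open>Mellin transform and moments\<close>

lemma summable_hyp2F1:
  fixes a b c x :: real
  assumes "c > 0" and "\<bar>x\<bar> < 1"
  shows "summable (\<lambda>k. pochhammer a k * pochhammer b k / pochhammer c k * (x ^ k / fact k))"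
    (is "summable ?f")
proof -
  \<comment> \<open>\<open>r k * x\<close> is the ratio of consecutive terms. It tends to
    \<open>x\<close>, so the midpoint of \<open>|x|\<close> and 1 can serve in the ratio
    test.\<close>
  define r where "r = (\<lambda>k. (a + real k) * (b + real k) / ((c + real k) * (real k + 1)))"
  have "r \<longlonglongrightarrow> 1" unfolding r_def by real_asymp
  then have "(\<lambda>k. \<bar>r k\<bar> * \<bar>x\<bar>) \<longlonglongrightarrow> \<bar>1\<bar> * \<bar>x\<bar>"
    by (intro tendsto_intros)
  moreover have "\<bar>1\<bar> * \<bar>x\<bar> < (1 + \<bar>x\<bar>) / 2" using assms by simp
  ultimately have "\<forall>\<^sub>F k in sequentially. \<bar>r k\<bar> * \<bar>x\<bar> < (1 + \<bar>x\<bar>) / 2"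
    by (rule order_tendstoD)
  then obtain N where N: "\<And>k. k \<ge> N \<Longrightarrow> \<bar>r k\<bar> * \<bar>x\<bar> < (1 + \<bar>x\<bar>) / 2"
    by (auto simp: eventually_sequentially)
  show ?thesis
  proof (rule summable_ratio_test[of "(1 + \<bar>x\<bar>) / 2" N])
    show "(1 + \<bar>x\<bar>) / 2 < 1" using assms by simp
  next
    fix k assume "N \<le> k"
    have pos: "pochhammer c k > 0" "c + real k > 0"
      using assms(1) by (auto intro: pochhammer_pos)
    have "?f (Suc k) = r k * x * ?f k"
      using pos by (simp add: r_def pochhammer_rec' field_simps)
    then have "norm (?f (Suc k)) = \<bar>r k\<bar> * \<bar>x\<bar> * norm (?f k)"
      by (simp add: abs_mult)
    also have "\<dots> \<le> (1 + \<bar>x\<bar>) / 2 * norm (?f k)"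
      using N[OF \<open>N \<le> k\<close>] by (intro mult_right_mono) auto
    finally show "norm (?f (Suc k)) \<le> (1 + \<bar>x\<bar>) / 2 * norm (?f k)" .
  qed
qed

text \<open>The terms are nonnegative and the first one is 1. This keeps the leading constants of
  the asymptotics away from 0.\<close>

lemma hyp2F1_pos:
  assumes "a > 0" "b > 0" "c > 0" "0 \<le> x" "x < 1"
  shows "hyp2F1 a b c x > 0"
  unfolding hyp2F1_def
proof (rule suminf_pos2)
  show "summable (\<lambda>k. pochhammer a k * pochhammer b k / pochhammer c k * (x ^ k / fact k))"
    using assms by (intro summable_hyp2F1) auto
  show "0 \<le> pochhammer a k * pochhammer b k / pochhammer c k * (x ^ k / fact k)" for k
    using assms by (intro mult_nonneg_nonneg divide_nonneg_nonneg pochhammer_nonneg) auto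
  show "0 < pochhammer a 0 * pochhammer b 0 / pochhammer c 0 * (x ^ 0 / fact 0)" by simp
qed

lemma nn_integral_mellin_bessel_K:
  fixes \<mu> m :: real
  assumes "\<mu> - m > 0" and "\<mu> + m > 0"
  shows "(\<integral>\<^sup>+x. ennreal (x powr (\<mu> - 1) * bessel_K m x) * indicator {0<..} x \<partial>lborel)
       = ennreal (2 powr (\<mu> - 2) * Gamma ((\<mu> - m) / 2) * Gamma ((\<mu> + m) / 2))"
proof -
  define a b where "a = (\<mu> - m) / 2" and "b = (\<mu> + m) / 2"
  have ab: "a > 0" "b > 0" "\<mu> = a + b" "m = b - a" using assms by (auto simp: a_def b_def field_simps)
  have triple: "ennreal h * (ennreal E * ennreal G) = ennreal (h * E * G)"
    if "h \<ge> 0" "E \<ge> 0" "G \<ge> 0" for h E G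
    using that by (simp add: ennreal_mult mult.assoc)
  \<comment> \<open>Here \<open>s = ln x\<close>. With \<open>q = 2 * s - p\<close> and
    \<open>m = b - a\<close> the linear part \<open>2 * a * s + m * p\<close> equals
    \<open>a * q + b * p\<close>, so the exponential splits into a function of \<open>p\<close>
    times a function of \<open>q\<close>. The outer 1/2 undoes the 2 in the logarithmic
    form.\<close>
  let ?g = "\<lambda>s p. exp (2 * a * s + m * p - exp p / 2 - exp (2 * s - p) / 2) / 2"
  have "(\<integral>\<^sup>+x. ennreal (x powr (\<mu> - 1) * bessel_K m x) * indicator {0<..} x \<partial>lborel)
      = (\<integral>\<^sup>+s. ennreal (exp s powr (\<mu> - 1) * bessel_K m (exp s) * exp s) \<partial>lborel)"
    by (rule nn_integral_exp_substitution) auto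
  also have "\<dots> = (\<integral>\<^sup>+s. \<integral>\<^sup>+p. ennreal (?g s p) \<partial>lborel \<partial>lborel)"
  proof (rule nn_integral_cong)
    fix s :: real
    have "ennreal (exp s powr (\<mu> - 1) * bessel_K m (exp s) * exp s)
        = ennreal (exp (2 * a * s) / 2) * ennreal (2 * (exp s powr m * bessel_K m (exp s)))"
      by (simp add: ab powr_def ennreal_mult'[symmetric] exp_add[symmetric] algebra_simps)
         (simp add: exp_add algebra_simps exp_minus exp_diff exp_double power2_eq_square field_simps)
    also have "\<dots> = (\<integral>\<^sup>+p. ennreal (exp (2 * a * s) / 2)
        * ennreal (exp (m * p - exp p / 2 - (exp s)\<^sup>2 * exp (- p) / 2)) \<partial>lborel)"
      by (subst nn_integral_powr_bessel_K[symmetric]) (simp_all add: nn_integral_cmult)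
    also have "\<dots> = (\<integral>\<^sup>+p. ennreal (?g s p) \<partial>lborel)"
      by (intro nn_integral_cong)
         (simp add: ennreal_mult'[symmetric] exp_double[symmetric] exp_add[symmetric] add_diff_eq)
    finally show "ennreal (exp s powr (\<mu> - 1) * bessel_K m (exp s) * exp s)
        = (\<integral>\<^sup>+p. ennreal (?g s p) \<partial>lborel)" .
  qed
  also have "\<dots> = (\<integral>\<^sup>+p. \<integral>\<^sup>+s. ennreal (?g s p) \<partial>lborel \<partial>lborel)"
    by (rule lborel_pair.Fubini'[symmetric]) simp
  also have "\<dots> = (\<integral>\<^sup>+p. ennreal (2 powr a * Gamma a / 4) * ennreal (exp (b * p - exp p / 2)) \<partial>lborel)"
  proof (rule nn_integral_cong)
    fix p :: real
    \<comment> \<open>For fixed \<open>p\<close> the substitution is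
      \<open>s = p / 2 + q / 2\<close>. Its Jacobian 1/2 and the outer 1/2 of \<open>?g\<close>
      account for the 2^(-2) in the result.\<close>
    have "(\<integral>\<^sup>+s. ennreal (?g s p) \<partial>lborel)
        = ennreal \<bar>1 / 2\<bar> * (\<integral>\<^sup>+q. ennreal (?g (p / 2 + 1 / 2 * q) p) \<partial>lborel)"
      by (rule nn_integral_real_affine) auto
    also have "(\<integral>\<^sup>+q. ennreal (?g (p / 2 + 1 / 2 * q) p) \<partial>lborel)
        = (\<integral>\<^sup>+q. ennreal (exp (b * p - exp p / 2) / 2) * ennreal (exp (a * q - exp q / 2)) \<partial>lborel)"
      by (intro nn_integral_cong)
         (simp add: ennreal_mult'[symmetric] exp_add[symmetric] ab algebra_simps)
    also have "\<dots> = ennreal (exp (b * p - exp p / 2) / 2) * ennreal (2 powr a * Gamma a)"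
      by (simp add: nn_integral_cmult nn_integral_Gamma_exp ab)
    also have "ennreal \<bar>1 / 2\<bar> * \<dots>
        = ennreal (\<bar>1 / 2\<bar> * (exp (b * p - exp p / 2) / 2) * (2 powr a * Gamma a))"
      using ab by (intro triple mult_nonneg_nonneg less_imp_le[OF Gamma_real_pos]) auto
    also have "\<dots> = ennreal (2 powr a * Gamma a / 4 * exp (b * p - exp p / 2))"
      by (simp add: mult_ac)
    also have "\<dots> = ennreal (2 powr a * Gamma a / 4) * ennreal (exp (b * p - exp p / 2))"
      by (rule ennreal_mult'') simp
    finally show "(\<integral>\<^sup>+s. ennreal (?g s p) \<partial>lborel)
        = ennreal (2 powr a * Gamma a / 4) * ennreal (exp (b * p - exp p / 2))"
      .
  qed
  also have "\<dots> = ennreal (2 powr a * Gamma a / 4) * ennreal (2 powr b * Gamma b)"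
    by (simp add: nn_integral_cmult nn_integral_Gamma_exp ab)
  also have "\<dots> = ennreal (2 powr (\<mu> - 2) * Gamma a * Gamma b)"
    using ab by (simp add: ennreal_mult''[symmetric] powr_diff powr_add
        less_imp_le[OF Gamma_real_pos] mult_ac)
  finally show ?thesis by (simp add: a_def b_def)
qed

lemma nn_integral_mellin_bessel_K_scaled:
  assumes "\<mu> - m > 0" and "\<mu> + m > 0" and "\<alpha> > 0"
  shows "(\<integral>\<^sup>+x. ennreal (x powr (\<mu> - 1) * bessel_K m (\<alpha> * x)) * indicator {0<..} x \<partial>lborel)
       = ennreal (\<alpha> powr (- \<mu>) * (2 powr (\<mu> - 2) * Gamma ((\<mu> - m) / 2) * Gamma ((\<mu> + m) / 2)))"
proof -
  have "(\<integral>\<^sup>+x. ennreal (x powr (\<mu> - 1) * bessel_K m (\<alpha> * x)) * indicator {0<..} x \<partial>lborel)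
     = ennreal \<bar>1 / \<alpha>\<bar> * (\<integral>\<^sup>+x. ennreal ((0 + 1 / \<alpha> * x) powr (\<mu> - 1)
          * bessel_K m (\<alpha> * (0 + 1 / \<alpha> * x))) * indicator {0<..} (0 + 1 / \<alpha> * x) \<partial>lborel)"
    using assms(3) by (intro nn_integral_real_affine) auto
  also have "\<dots> = ennreal \<bar>1 / \<alpha>\<bar> * (\<integral>\<^sup>+x. ennreal (\<alpha> powr (1 - \<mu>))
          * (ennreal (x powr (\<mu> - 1) * bessel_K m x) * indicator {0<..} x) \<partial>lborel)"
  proof (rule arg_cong2[where f = "(*)", OF refl nn_integral_cong])
    fix x :: real
    have "(0 + 1 / \<alpha> * x) powr (\<mu> - 1) = \<alpha> powr (1 - \<mu>) * x powr (\<mu> - 1)" if "x > 0"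
      using assms(3) that by (simp add: powr_divide powr_diff field_simps)
    then show "ennreal ((0 + 1 / \<alpha> * x) powr (\<mu> - 1) * bessel_K m (\<alpha> * (0 + 1 / \<alpha> * x)))
          * indicator {0<..} (0 + 1 / \<alpha> * x)
        = ennreal (\<alpha> powr (1 - \<mu>)) * (ennreal (x powr (\<mu> - 1) * bessel_K m x) * indicator {0<..} x)"
      using assms(3)
      by (cases "x > 0") (auto simp: ennreal_mult'[symmetric] zero_less_divide_iff mult_ac)
  qed
  also have "\<dots> = ennreal \<bar>1 / \<alpha>\<bar> * (ennreal (\<alpha> powr (1 - \<mu>)) *
      ennreal (2 powr (\<mu> - 2) * Gamma ((\<mu> - m) / 2) * Gamma ((\<mu> + m) / 2)))"
    using assms by (simp add: nn_integral_cmult nn_integral_mellin_bessel_K)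
  also have "\<dots> = ennreal (\<alpha> powr (- \<mu>)
      * (2 powr (\<mu> - 2) * Gamma ((\<mu> - m) / 2) * Gamma ((\<mu> + m) / 2)))"
    using assms by (simp add: ennreal_mult'[symmetric] powr_diff powr_minus field_simps)
  finally show ?thesis .
qed

lemma cosh_sums_even: "(\<lambda>k. x ^ (2 * k) / fact (2 * k)) sums cosh (x :: real)"
proof -
  have "(\<lambda>k. (if even (2 * k) then x ^ (2 * k) /\<^sub>R fact (2 * k) else 0)) sums cosh x
      \<longleftrightarrow> (\<lambda>k. if even k then x ^ k /\<^sub>R fact k else 0) sums cosh x"
    by (rule sums_mono_reindex) (auto simp: strict_mono_def elim!: evenE)
  then show ?thesis using cosh_converges[of x] by (simp add: divide_inverse mult.commute)
qed

text \<open>Each even power of \<open>\<beta> * u\<close> contributes a Mellin transform whose Gamma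
  arguments are shifted by \<open>k\<close>, which creates the two upper Pochhammer symbols. The
  lower parameter 1/2 comes from
  \<open>fact (2 * k) = 2 ^ (2 * k) * pochhammer (1/2) k * fact k\<close>. Odd powers cancel in the
  folding, so all terms are nonnegative and sum and integral may be exchanged.\<close>

lemma nn_integral_moment_bessel_K:
  fixes s m \<alpha> \<beta> :: real
  assumes "s + 1 > 0" and "s + 1 + 2 * m > 0" and "\<bar>\<beta>\<bar> < \<alpha>"
  shows "(\<integral>\<^sup>+u. ennreal (\<bar>u\<bar> powr s * (exp (\<beta> * u) * \<bar>u\<bar> powr m * bessel_K m (\<alpha> * \<bar>u\<bar>))) \<partial>lborel)
       = ennreal (2 powr (s + m) * \<alpha> powr (- (s + m + 1)) * Gamma ((s + 1) / 2) * Gamma ((s + 1) / 2 + m)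
           * hyp2F1 ((s + 1) / 2) ((s + 1) / 2 + m) (1 / 2) (\<beta>\<^sup>2 / \<alpha>\<^sup>2))"
proof -
  define a b where "a = (s + 1) / 2" and "b = (s + 1) / 2 + m"
  define C where "C = 2 powr (s + m) * \<alpha> powr (- (s + m + 1)) * Gamma a * Gamma b"
  define h where "h = (\<lambda>k. pochhammer a k * pochhammer b k / pochhammer (1/2) k
      * ((\<beta>\<^sup>2 / \<alpha>\<^sup>2) ^ k / fact k))"
  have \<alpha>: "\<alpha> > 0" using assms(3) by linarith
  have "a > 0" using assms(1) unfolding a_def by simp
  moreover have "b > 0" using assms(2) unfolding b_def by argo
  ultimately have ab: "a > 0" "b > 0" by auto
  have C: "C \<ge> 0" 
    unfolding C_def using ab by (intro mult_nonneg_nonneg less_imp_le[OF Gamma_real_pos]) auto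
  have "\<beta>\<^sup>2 < \<alpha>\<^sup>2" using power_strict_mono[OF assms(3), of 2] by simp
  then have x: "\<bar>\<beta>\<^sup>2 / \<alpha>\<^sup>2\<bar> < 1" using \<alpha> by (simp add: divide_less_eq_1)
  have summable: "summable h" unfolding h_def by (rule summable_hyp2F1) (use x in auto)
  have h: "h k \<ge> 0" for k
    unfolding h_def using ab by (intro mult_nonneg_nonneg divide_nonneg_nonneg pochhammer_nonneg) auto
  have coeff: "2 * \<beta> ^ (2 * k) / fact (2 * k) \<ge> 0" for k
    by (intro divide_nonneg_nonneg mult_nonneg_nonneg) (auto simp: zero_le_even_power)
  \<comment> \<open>The exponent keeps the form \<open>s + m + 2 * real k + 1 - 1\<close> in order
    to match \<open>\<mu> - 1\<close> in the Mellin transform.\<close>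
  have series: "ennreal (\<bar>u\<bar> powr s * (exp (\<beta> * u) * \<bar>u\<bar> powr m * bessel_K m (\<alpha> * \<bar>u\<bar>)))
       + ennreal (\<bar>- u\<bar> powr s * (exp (\<beta> * - u) * \<bar>- u\<bar> powr m * bessel_K m (\<alpha> * \<bar>- u\<bar>)))
      = (\<Sum>k. ennreal (2 * \<beta> ^ (2 * k) / fact (2 * k))
          * ennreal (u powr (s + m + 2 * real k + 1 - 1) * bessel_K m (\<alpha> * u)))" if "u > 0" for u
  proof -
    have "exp (\<beta> * u) + exp (\<beta> * - u) = 2 * cosh (\<beta> * u)" by (simp add: cosh_field_def)
    moreover have "\<bar>u\<bar> powr s * (exp (\<beta> * u) * \<bar>u\<bar> powr m * bessel_K m (\<alpha> * \<bar>u\<bar>))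
       + \<bar>- u\<bar> powr s * (exp (\<beta> * - u) * \<bar>- u\<bar> powr m * bessel_K m (\<alpha> * \<bar>- u\<bar>))
       = u powr (s + m) * bessel_K m (\<alpha> * u) * (exp (\<beta> * u) + exp (\<beta> * - u))"
      using that by (simp add: powr_add algebra_simps)
    ultimately have "ennreal (\<bar>u\<bar> powr s * (exp (\<beta> * u) * \<bar>u\<bar> powr m * bessel_K m (\<alpha> * \<bar>u\<bar>)))
       + ennreal (\<bar>- u\<bar> powr s * (exp (\<beta> * - u) * \<bar>- u\<bar> powr m * bessel_K m (\<alpha> * \<bar>- u\<bar>)))
       = ennreal (2 * u powr (s + m) * bessel_K m (\<alpha> * u) * cosh (\<beta> * u))"
      by (subst ennreal_plus[symmetric]) (auto simp: bessel_K_nonneg mult_ac)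
    also have "\<dots> = (\<Sum>k. ennreal (2 * u powr (s + m) * bessel_K m (\<alpha> * u)
        * ((\<beta> * u) ^ (2 * k) / fact (2 * k))))"
    proof (rule suminf_ennreal_eq[symmetric])
      show "0 \<le> 2 * u powr (s + m) * bessel_K m (\<alpha> * u) * ((\<beta> * u) ^ (2 * k) / fact (2 * k))" for k
        by (intro mult_nonneg_nonneg divide_nonneg_nonneg bessel_K_nonneg)
           (auto simp: zero_le_even_power)
      show "(\<lambda>k. 2 * u powr (s + m) * bessel_K m (\<alpha> * u) * ((\<beta> * u) ^ (2 * k) / fact (2 * k)))
          sums (2 * u powr (s + m) * bessel_K m (\<alpha> * u) * cosh (\<beta> * u))"
        by (intro sums_mult cosh_sums_even)
    qed
    also have "\<dots> = (\<Sum>k. ennreal (2 * \<beta> ^ (2 * k) / fact (2 * k))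
          * ennreal (u powr (s + m + 2 * real k + 1 - 1) * bessel_K m (\<alpha> * u)))"
    proof (rule suminf_cong)
      fix k
      have "u ^ (2 * k) = u powr (2 * real k)" using that by (simp add: powr_realpow[symmetric])
      then show "ennreal (2 * u powr (s + m) * bessel_K m (\<alpha> * u) * ((\<beta> * u) ^ (2 * k) / fact (2 * k)))
        = ennreal (2 * \<beta> ^ (2 * k) / fact (2 * k))
          * ennreal (u powr (s + m + 2 * real k + 1 - 1) * bessel_K m (\<alpha> * u))"
        by (subst ennreal_mult'[OF coeff, symmetric]) (simp_all add: powr_add power_mult_distrib mult_ac)
    qed
    finally show ?thesis .
  qed
  have moment: "ennreal (2 * \<beta> ^ (2 * k) / fact (2 * k))
      * (\<integral>\<^sup>+u. ennreal (u powr (s + m + 2 * real k + 1 - 1) * bessel_K m (\<alpha> * u)) * indicator {0<..} u \<partial>lborel)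
      = ennreal (C * h k)" for k
  proof -
    have "Gamma (c + real k) = pochhammer c k * Gamma c" if "c > 0" for c :: real
    proof -
      have "c \<notin> \<int>\<^sub>\<le>\<^sub>0" using that by (auto elim!: nonpos_Ints_cases)
      then show ?thesis using pochhammer_Gamma[of c k] Gamma_real_pos[OF that] by simp
    qed
    then have gammas: "Gamma (a + real k) = pochhammer a k * Gamma a" "Gamma (b + real k) = pochhammer b k * Gamma b"
      using ab by auto
    have args: "(s + m + 2 * real k + 1 - m) / 2 = a + real k"
      "(s + m + 2 * real k + 1 + m) / 2 = b + real k" by (simp_all add: a_def b_def field_simps)
    have two: "2 powr (s + m + 2 * real k + 1 - 2) = 2 powr (s + m) * 2 ^ (2 * k) / 2"
      using powr_realpow[of 2 "2 * k"] by (simp add: powr_add powr_diff)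
    have alpha: "\<alpha> powr (- (s + m + 2 * real k + 1)) = \<alpha> powr (- (s + m + 1)) / \<alpha> ^ (2 * k)"
      using powr_realpow[OF \<alpha>, of "2 * k"] \<alpha>
      by (simp add: powr_add powr_diff powr_minus field_simps)
    have total: "2 * \<beta> ^ (2 * k) / fact (2 * k) * (\<alpha> powr (- (s + m + 1)) / \<alpha> ^ (2 * k) *
        (2 powr (s + m) * 2 ^ (2 * k) / 2 * (pochhammer a k * Gamma a) * (pochhammer b k * Gamma b))) = C * h k"
      unfolding C_def h_def fact_double power_divide power_mult[symmetric]
      by (simp add: mult_ac)
    have pos: "s + m + 2 * real k + 1 - m > 0" "s + m + 2 * real k + 1 + m > 0" using assms by auto
    show ?thesis
      unfolding nn_integral_mellin_bessel_K_scaled[OF pos \<alpha>] ennreal_mult'[OF coeff, symmetric]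
        args gammas two alpha total ..
  qed
  have "(\<integral>\<^sup>+u. ennreal (\<bar>u\<bar> powr s * (exp (\<beta> * u) * \<bar>u\<bar> powr m * bessel_K m (\<alpha> * \<bar>u\<bar>))) \<partial>lborel)
      = (\<integral>\<^sup>+u. (\<Sum>k. ennreal (2 * \<beta> ^ (2 * k) / fact (2 * k))
          * (ennreal (u powr (s + m + 2 * real k + 1 - 1) * bessel_K m (\<alpha> * u)) * indicator {0<..} u)) \<partial>lborel)"
    by (subst nn_integral_lborel_fold, simp, intro nn_integral_cong)
       (use series in \<open>auto simp: indicator_def\<close>)
  also have "\<dots> = (\<Sum>k. ennreal (C * h k))"
    by (subst nn_integral_suminf) (auto simp: nn_integral_cmult simp flip: moment)
  also have "\<dots> = ennreal (C * suminf h)"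
    using C h summable by (intro suminf_ennreal_eq sums_mult summable_sums) auto
  finally show ?thesis
    by (simp add: C_def h_def a_def b_def hyp2F1_def)
qed

section \<open>Behaviour of the Bessel function at the origin\<close>

text \<open>Dropping the term with \<open>x\<^sup>2\<close> from the exponent of the logarithmic
  form only increases it and leaves a Gamma integral. The bound is the limit at the origin, hence
  sharp.\<close>

lemma powr_bessel_K_le:
  assumes "n > 0" "x > 0"
  shows "x powr n * bessel_K n x \<le> 2 powr (n - 1) * Gamma n"
proof -
  have "ennreal (2 * (x powr n * bessel_K n x)) \<le> (\<integral>\<^sup>+t. ennreal (exp (n * t - exp t / 2)) \<partial>lborel)"
    unfolding nn_integral_powr_bessel_K[OF assms(2), symmetric] by (intro nn_integral_mono) simp
  then have "2 * (x powr n * bessel_K n x) \<le> 2 powr n * Gamma n"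
    using assms
    by (simp add: nn_integral_Gamma_exp ennreal_le_iff less_imp_le[OF Gamma_real_pos])
  then show ?thesis by (simp add: powr_diff)
qed

text \<open>The integrand without the term in \<open>c / z\<close> dominates for all
  \<open>z\<close> and is also the pointwise limit. The argument is \<open>c / z\<close> because
  later \<open>c\<close> is a fixed multiple of |u| while \<open>z\<close> grows.\<close>

lemma tendsto_powr_bessel_K:
  assumes "n > 0" "c > 0"
  shows "((\<lambda>z. (c / z) powr n * bessel_K n (c / z)) \<longlongrightarrow> 2 powr (n - 1) * Gamma n) at_top"
proof -
  let ?s = "\<lambda>z t. exp (n * t - exp t / 2 - (c / z)\<^sup>2 * exp (- t) / 2)"
  let ?f = "\<lambda>t. exp (n * t - exp t / 2)"
  have integral_f: "integral\<^sup>L lborel ?f = 2 powr n * Gamma n"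
    by (subst integral_eq_nn_integral) (use assms in \<open>auto simp: nn_integral_Gamma_exp\<close>)
  have "((\<lambda>z. integral\<^sup>L lborel (?s z)) \<longlongrightarrow> integral\<^sup>L lborel ?f) at_top"
  proof (rule integral_dominated_convergence_at_top)
    show "integrable lborel ?f"
      by (rule integrableI_nonneg) (use assms in \<open>auto simp: nn_integral_Gamma_exp\<close>)
    have "((\<lambda>z. c / z) \<longlongrightarrow> 0) at_top"
      by (intro tendsto_divide_0[OF tendsto_const] filterlim_at_top_imp_at_infinity filterlim_ident)
    then have "((\<lambda>z. ?s z t) \<longlongrightarrow> exp (n * t - exp t / 2 - 0\<^sup>2 * exp (- t) / 2)) at_top" for t
      by (intro tendsto_intros) auto
    then show "AE t in lborel. ((\<lambda>z. ?s z t) \<longlongrightarrow> ?f t) at_top" by simp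
  qed auto
  then have "((\<lambda>z. integral\<^sup>L lborel (?s z) / 2) \<longlongrightarrow> integral\<^sup>L lborel ?f / 2) at_top"
    by (intro tendsto_divide tendsto_const) auto
  moreover have "integral\<^sup>L lborel (?s z) / 2 = (c / z) powr n * bessel_K n (c / z)" if "z > 0" for z
    using assms that
    by (subst integral_eq_nn_integral) (auto simp: nn_integral_powr_bessel_K bessel_K_nonneg)
  then have "\<forall>\<^sub>F z in at_top. integral\<^sup>L lborel (?s z) / 2 = (c / z) powr n * bessel_K n (c / z)"
    by (intro eventually_mono[OF eventually_gt_at_top[of 0]])
  ultimately show ?thesis
    by (simp add: integral_f powr_diff tendsto_cong)
qed

section \<open>Order zero: logarithmic growth at the origin\<close>

lemma nn_integral_bessel_K_0:
  assumes "x > 0"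
  shows "(\<integral>\<^sup>+t. ennreal (exp (- (x * cosh t))) * indicator {0<..} t \<partial>lborel) = ennreal (bessel_K 0 x)"
proof -
  have [measurable]: "cosh \<in> borel_measurable (borel :: real measure)"
    unfolding cosh_field_def[abs_def] by measurable
  have "2 * (\<integral>\<^sup>+t. ennreal (exp (- (x * cosh t))) * indicator {0<..} t \<partial>lborel)
      = (\<integral>\<^sup>+t. ennreal (exp (- (x * cosh t))) \<partial>lborel)"
    by (subst (2) nn_integral_lborel_fold, simp, subst nn_integral_cmult[symmetric], simp)
       (auto intro!: nn_integral_cong simp: mult_2 distrib_right)
  also have "\<dots> = 2 * ennreal (bessel_K 0 x)"
    using nn_integral_bessel_K[OF assms, of 0] by (simp add: ennreal_mult' flip: ennreal_numeral)
  finally show ?thesis by (simp add: ennreal_mult_cancel_left)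
qed

text \<open>With \<open>L = max 0 (- ln x)\<close> the integrand is at most 1 on [0, L). Beyond
  \<open>L\<close>, \<open>2 * x * cosh t\<close> is at least \<open>exp (t + ln x)\<close>, hence
  at least \<open>t - L\<close>, and the resulting exponential tail integrates to 2. The maximum
  makes the bound valid for large \<open>x\<close> too.\<close>

lemma bessel_K_0_le:
  assumes "x > 0"
  shows "bessel_K 0 x \<le> max 0 (- ln x) + 2"
proof -
  define L where "L = max 0 (- ln x)"
  have L: "L \<ge> 0" "- ln x \<le> L" by (auto simp: L_def)
  have le: "exp (- (x * cosh t)) \<le> exp (- ((t - L) / 2))" if "t \<ge> L" for t
  proof -
    have "t - L \<le> ln x + t" using L by linarith
    also have "\<dots> \<le> exp (ln x + t)" using exp_ge_add_one_self[of "ln x + t"] by linarith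
    also have "\<dots> = x * exp t" using assms by (simp add: exp_add)
    also have "\<dots> \<le> x * (2 * cosh t)"
      using assms by (intro mult_left_mono) (auto simp: cosh_field_def)
    finally show ?thesis by simp
  qed
  have "ennreal (bessel_K 0 x)
      \<le> (\<integral>\<^sup>+t. indicator {0..<L} t + ennreal (exp (- ((t - L) / 2))) * indicator {L..} t \<partial>lborel)"
    unfolding nn_integral_bessel_K_0[OF assms, symmetric]
    using assms le by (intro nn_integral_mono) (auto simp: indicator_def not_le)
  also have "\<dots> = (\<integral>\<^sup>+t. indicator {0..<L} t \<partial>lborel)
      + (\<integral>\<^sup>+t. ennreal (exp (- ((t - L) / 2))) * indicator {L..} t \<partial>lborel)"
    by (rule nn_integral_add) auto
  also have "(\<integral>\<^sup>+t. indicator {0..<L} t \<partial>lborel) = ennreal L" using L by simp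
  also have "(\<integral>\<^sup>+t. ennreal (exp (- ((t - L) / 2))) * indicator {L..} t \<partial>lborel)
      = ennreal (0 - (- 2 * exp (- ((L - L) / 2))))"
  proof (rule nn_integral_FTC_atLeast[where F = "\<lambda>t. - 2 * exp (- ((t - L) / 2))"])
    show "((\<lambda>t. - 2 * exp (- ((t - L) / 2))) \<longlongrightarrow> 0) at_top" by real_asymp
  qed (auto intro!: derivative_eq_intros)
  also have "ennreal L + ennreal (0 - (- 2 * exp (- ((L - L) / 2)))) = ennreal (L + 2)"
    using L by (simp flip: ennreal_numeral)
  finally have "bessel_K 0 x \<le> L + 2" using L by (subst (asm) ennreal_le_iff) auto
  then show ?thesis by (simp add: L_def)
qed

text \<open>On [0, - ln x] the integrand is at least \<open>1 - x * exp t\<close>, by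
  \<open>exp (- y) \<ge> 1 - y\<close> and \<open>cosh t \<le> exp t\<close>. With
  \<open>L = - ln x\<close> this minorant integrates to \<open>L - 1 + exp (- L)\<close>.\<close>

lemma bessel_K_0_ge:
  assumes "0 < x" "x \<le> 1"
  shows "bessel_K 0 x \<ge> - ln x - 1"
proof -
  define L where "L = - ln x"
  have L: "L \<ge> 0" "x = exp (- L)" using assms by (auto simp: L_def)
  have le: "1 - exp (t - L) \<le> exp (- (x * cosh t))" if "t \<ge> 0" for t
  proof -
    have "x * cosh t \<le> x * exp t"
      using assms that by (intro mult_left_mono) (auto simp: cosh_field_def)
    also have "\<dots> = exp (t - L)" by (simp add: L(2) exp_minus exp_diff divide_inverse)
    finally show ?thesis using exp_ge_add_one_self[of "- (x * cosh t)"] by linarith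
  qed
  have "(\<integral>\<^sup>+t. ennreal (1 - exp (t - L)) * indicator {0..L} t \<partial>lborel)
      = ennreal ((L - exp (L - L)) - (0 - exp (0 - L)))"
    by (rule nn_integral_FTC_Icc[where F = "\<lambda>t. t - exp (t - L)"]) (use L in \<open>auto intro!: derivative_eq_intros\<close>)
  moreover have "(\<integral>\<^sup>+t. ennreal (1 - exp (t - L)) * indicator {0..L} t \<partial>lborel)
      \<le> (\<integral>\<^sup>+t. ennreal (exp (- (x * cosh t))) * indicator {0<..} t \<partial>lborel)"
    by (intro nn_integral_mono_AE AE_I[of _ _ "{0}"])
       (use le in \<open>auto simp: indicator_def split: if_splits intro!: ennreal_leI\<close>)
  ultimately have "ennreal ((L - exp (L - L)) - (0 - exp (0 - L))) \<le> ennreal (bessel_K 0 x)"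
    unfolding nn_integral_bessel_K_0[OF assms(1)] by simp
  then have "(L - exp (L - L)) - (0 - exp (0 - L)) \<le> bessel_K 0 x"
    by (simp add: ennreal_le_iff bessel_K_nonneg)
  moreover have "exp (0 - L) \<ge> 0" "exp (L - L) = 1" by simp_all
  ultimately have "L - 1 \<le> bessel_K 0 x" by linarith
  then show ?thesis by (simp add: L_def)
qed

lemma tendsto_bessel_K_0_over_ln:
  assumes "c > 0"
  shows "((\<lambda>z. bessel_K 0 (c / z) / ln z) \<longlongrightarrow> 1) at_top"
proof (rule tendsto_sandwich)
  show "((\<lambda>z. (ln z - ln c - 1) / ln z) \<longlongrightarrow> 1) at_top" by real_asymp
  show "((\<lambda>z. (ln z - ln c + 2) / ln z) \<longlongrightarrow> 1) at_top" by real_asymp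
  \<comment> \<open>\<open>z > c\<close> puts \<open>c / z\<close> into (0, 1), where the lower
    bound is available and the maximum in the upper bound equals \<open>- ln (c / z)\<close>;
    \<open>z > 1\<close> makes \<open>ln z\<close> positive.\<close>
  have ev: "\<forall>\<^sub>F z in at_top. z > max c 1" by (rule eventually_gt_at_top)
  show "\<forall>\<^sub>F z in at_top. (ln z - ln c - 1) / ln z \<le> bessel_K 0 (c / z) / ln z"
    using ev
  proof eventually_elim
    case (elim z)
    then show ?case using assms bessel_K_0_ge[of "c / z"]
      by (intro divide_right_mono) (auto simp: ln_div)
  qed
  show "\<forall>\<^sub>F z in at_top. bessel_K 0 (c / z) / ln z \<le> (ln z - ln c + 2) / ln z"
    using ev
  proof eventually_elim
    case (elim z)
    then have "ln c \<le> ln z" using assms by (subst ln_le_cancel_iff) auto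
    with elim show ?case using assms bessel_K_0_le[of "c / z"]
      by (intro divide_right_mono) (auto simp: ln_div)
  qed
qed

text \<open>The variance-gamma density without its normalizing constant. The constant depends on
  \<beta>, so leaving it out allows \<beta> to be shifted by a small amount for the majorant and to
  change sign for negative \<open>z\<close>.\<close>

definition vg_kernel :: "real \<Rightarrow> real \<Rightarrow> real \<Rightarrow> real \<Rightarrow> real" where
  "vg_kernel m \<alpha> \<beta> u = exp (\<beta> * u) * \<bar>u\<bar> powr m * bessel_K m (\<alpha> * \<bar>u\<bar>)"

lemma borel_measurable_vg_kernel [measurable]: "vg_kernel m \<alpha> \<beta> \<in> borel_measurable borel"
  unfolding vg_kernel_def[abs_def] by measurable

lemma vg_kernel_nonneg: "vg_kernel m \<alpha> \<beta> u \<ge> 0"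
  unfolding vg_kernel_def by (intro mult_nonneg_nonneg bessel_K_nonneg) auto

lemma vg_kernel_0: "vg_kernel m \<alpha> \<beta> 0 = 0"
  by (simp add: vg_kernel_def)

lemma vg_kernel_uminus: "vg_kernel m \<alpha> \<beta> (- u) = vg_kernel m \<alpha> (- \<beta>) u"
  by (simp add: vg_kernel_def)

lemma
  fixes s m \<alpha> \<beta> :: real
  assumes "s + 1 > 0" and "s + 1 + 2 * m > 0" and "\<bar>\<beta>\<bar> < \<alpha>"
  shows integrable_moment_vg_kernel: "integrable lborel (\<lambda>u. \<bar>u\<bar> powr s * vg_kernel m \<alpha> \<beta> u)"
    and integral_moment_vg_kernel: "(LINT u|lborel. \<bar>u\<bar> powr s * vg_kernel m \<alpha> \<beta> u)
      = 2 powr (s + m) * \<alpha> powr (- (s + m + 1)) * Gamma ((s + 1) / 2) * Gamma ((s + 1) / 2 + m)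
         * hyp2F1 ((s + 1) / 2) ((s + 1) / 2 + m) (1 / 2) (\<beta>\<^sup>2 / \<alpha>\<^sup>2)" (is "_ = ?r")
proof -
  have nn: "(\<integral>\<^sup>+u. ennreal (\<bar>u\<bar> powr s * vg_kernel m \<alpha> \<beta> u) \<partial>lborel) = ennreal ?r"
    using nn_integral_moment_bessel_K[OF assms] by (simp add: vg_kernel_def)
  show "integrable lborel (\<lambda>u. \<bar>u\<bar> powr s * vg_kernel m \<alpha> \<beta> u)"
    by (rule integrableI_nonneg) (auto simp: nn vg_kernel_nonneg)
  \<comment> \<open>\<open>ennreal\<close> sends negative reals to 0, so the real value can be
    recovered only after \<open>?r\<close> is known to be nonnegative.\<close>
  have pos: "(s + 1) / 2 > 0" "(s + 1) / 2 + m > 0" using assms by argo+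
  have "\<beta>\<^sup>2 < \<alpha>\<^sup>2" using power_strict_mono[OF assms(3), of 2] by simp
  then have "hyp2F1 ((s + 1) / 2) ((s + 1) / 2 + m) (1 / 2) (\<beta>\<^sup>2 / \<alpha>\<^sup>2) > 0"
    using pos assms(3) by (intro hyp2F1_pos) (auto simp: divide_less_eq_1)
  then have "?r \<ge> 0"
    using pos by (intro mult_nonneg_nonneg less_imp_le[OF Gamma_real_pos]) auto
  then show "(LINT u|lborel. \<bar>u\<bar> powr s * vg_kernel m \<alpha> \<beta> u) = ?r"
    by (subst integral_eq_nn_integral) (auto simp: nn vg_kernel_nonneg)
qed

lemma ratio_density_scale:
  assumes "z > 0"
  shows "z\<^sup>2 * ratio_density f g z = (LINT u|lborel. \<bar>u\<bar> * f u * g (u / z))"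
proof -
  have "ratio_density f g z
      = \<bar>1 / z\<bar> *\<^sub>R (LINT u|lborel. \<bar>0 + 1 / z * u\<bar> * f ((0 + 1 / z * u) * z) * g (0 + 1 / z * u))"
    unfolding ratio_density_def using assms by (intro lborel_integral_real_affine) auto
  also have "\<dots> = 1 / z * (LINT u|lborel. 1 / z * (\<bar>u\<bar> * f u * g (u / z)))"
    using assms by (simp add: abs_mult)
  also have "\<dots> = 1 / z\<^sup>2 * (LINT u|lborel. \<bar>u\<bar> * f u * g (u / z))"
    by (subst integral_mult_right_zero) (simp add: power2_eq_square)
  finally show ?thesis using assms by simp
qed

section \<open>Asymptotics of the ratio density\<close>

text \<open>Dominated convergence for all three regimes at once: \<open>\<psi>\<close> is the kernel
  of Y without its exponential factor, and \<open>\<phi>\<close> is the growth rate of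
  \<open>\<psi> (u / z)\<close>, later \<open>z powr (- r)\<close> or \<open>ln z\<close>. The
  majorant \<open>1 / |u| + |u|\<close> is large enough for any power |u|^r with -1 < r \<le> 0 and
  for a logarithm; multiplied by the weight |u| it becomes 1 + |u|^2, whose moments are finite for
  every m > -1/2. The limit is \<open>A\<close> times the moment of order
  \<open>1 + r\<close>.\<close>

lemma tendsto_ratio_density_vg_kernel:
  fixes m r \<alpha> \<beta> \<delta> A C :: real and \<psi> \<phi> :: "real \<Rightarrow> real"
  assumes m: "m > - 1/2" and \<beta>: "\<bar>\<beta>\<bar> < \<alpha>" and r: "r > - 1"
    and [measurable]: "\<psi> \<in> borel_measurable borel"
    and \<phi>: "\<forall>\<^sub>F z in at_top. \<phi> z > 0"
    and nonneg: "\<And>y. \<psi> y \<ge> 0"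
    and bound: "\<forall>\<^sub>F z in at_top. \<forall>u. u \<noteq> 0 \<longrightarrow> \<psi> (u / z) / \<phi> z \<le> C * (1 / \<bar>u\<bar> + \<bar>u\<bar>)"
    and lim: "\<And>u. u \<noteq> 0 \<Longrightarrow> ((\<lambda>z. \<psi> (u / z) / \<phi> z) \<longlongrightarrow> A * \<bar>u\<bar> powr r) at_top"
  shows "((\<lambda>z. z\<^sup>2 / \<phi> z * ratio_density (vg_kernel m \<alpha> \<beta>) (\<lambda>y. exp (\<delta> * y) * \<psi> y) z) \<longlongrightarrow>
      A * (2 powr (1 + r + m) * \<alpha> powr (- (r + m + 2)) * Gamma (r / 2 + 1) * Gamma (r / 2 + 1 + m)
        * hyp2F1 (r / 2 + 1) (r / 2 + 1 + m) (1 / 2) (\<beta>\<^sup>2 / \<alpha>\<^sup>2))) at_top"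
proof -
  define q where "q = vg_kernel m \<alpha>"
  have [measurable]: "q b \<in> borel_measurable borel" for b by (simp add: q_def)
  have q_nonneg: "q b u \<ge> 0" for b u by (simp add: q_def vg_kernel_nonneg)
  have q_0: "q b 0 = 0" for b by (simp add: q_def vg_kernel_0)
  define \<epsilon> where "\<epsilon> = (\<alpha> - \<bar>\<beta>\<bar>) / 2"
  have \<epsilon>: "\<epsilon> > 0" "\<bar>\<beta> + \<epsilon>\<bar> < \<alpha>" "\<bar>\<beta> - \<epsilon>\<bar> < \<alpha>" 
  proof -
    have "2 * \<epsilon> = \<alpha> - \<bar>\<beta>\<bar>" by (simp add: \<epsilon>_def)
    then show "\<epsilon> > 0" "\<bar>\<beta> + \<epsilon>\<bar> < \<alpha>" "\<bar>\<beta> - \<epsilon>\<bar> < \<alpha>" using \<beta> by linarith+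
  qed
  (* For z \<ge> |\<delta>|/\<epsilon> the factor exp (\<delta> u/z) costs at most exp (\<epsilon> |u|), which shifts \<beta> to
     \<beta> + \<epsilon> or \<beta> - \<epsilon> and keeps the kernel integrable. *)
  let ?s = "\<lambda>z u. \<bar>u\<bar> * q \<beta> u * (exp (\<delta> * (u / z)) * (\<psi> (u / z) / \<phi> z))"
  let ?f = "\<lambda>u. A * (\<bar>u\<bar> powr (1 + r) * q \<beta> u)"
  let ?w = "\<lambda>u. C * ((\<bar>u\<bar> powr 0 + \<bar>u\<bar> powr 2) * (q (\<beta> + \<epsilon>) u + q (\<beta> - \<epsilon>) u))"
  have "((\<lambda>z. integral\<^sup>L lborel (?s z)) \<longlongrightarrow> integral\<^sup>L lborel ?f) at_top"
  proof (rule integral_dominated_convergence_at_top)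
    \<comment> \<open>The powers are written with \<open>powr\<close> so that the summands are
      moments of orders 0 and 2. The convention \<open>0 powr 0 = 0\<close> is harmless because the
      kernel vanishes at 0.\<close>
    have "integrable lborel (\<lambda>u. C * (\<bar>u\<bar> powr 0 * q (\<beta> + \<epsilon>) u + \<bar>u\<bar> powr 0 * q (\<beta> - \<epsilon>) u
        + (\<bar>u\<bar> powr 2 * q (\<beta> + \<epsilon>) u + \<bar>u\<bar> powr 2 * q (\<beta> - \<epsilon>) u)))"
      unfolding q_def using m \<epsilon>
      by (intro integrable_mult_right Bochner_Integration.integrable_add integrable_moment_vg_kernel) auto
    then show "integrable lborel ?w" by (simp add: algebra_simps)
    show "AE u in lborel. ((\<lambda>z. ?s z u) \<longlongrightarrow> ?f u) at_top"
    proof (rule AE_I2)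
      fix u :: real
      show "((\<lambda>z. ?s z u) \<longlongrightarrow> ?f u) at_top"
      proof (cases "u = 0")
        case False
        have "((\<lambda>z. u / z) \<longlongrightarrow> 0) at_top"
          by (intro tendsto_divide_0[OF tendsto_const] filterlim_at_top_imp_at_infinity filterlim_ident)
        then have "((\<lambda>z. ?s z u) \<longlongrightarrow> \<bar>u\<bar> * q \<beta> u * (exp (\<delta> * 0) * (A * \<bar>u\<bar> powr r))) at_top"
          using lim[OF False] by (intro tendsto_intros)
        then show ?thesis using False by (simp add: powr_add mult_ac)
      qed (simp add: q_0)
    qed
    have "\<forall>\<^sub>F z in at_top. z > max 1 (\<bar>\<delta>\<bar> / \<epsilon>)" by (rule eventually_gt_at_top)
    with \<phi> bound show "\<forall>\<^sub>F z in at_top. AE u in lborel. norm (?s z u) \<le> ?w u"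
    proof eventually_elim
      case (elim z)
      then have z: "z > 0" "\<bar>\<delta>\<bar> / z \<le> \<epsilon>" using \<epsilon>(1) by (auto simp: field_simps)
      show ?case
      proof (rule AE_I2)
        fix u :: real
        show "norm (?s z u) \<le> ?w u"
        proof (cases "u = 0")
          case False
          have "\<delta> * (u / z) \<le> (\<bar>\<delta>\<bar> / z) * \<bar>u\<bar>"
            using z(1) abs_ge_self[of "\<delta> * u"] by (simp add: divide_right_mono abs_mult)
          also have "\<dots> \<le> \<epsilon> * \<bar>u\<bar>" using z by (intro mult_right_mono) auto
          finally have "exp (\<delta> * (u / z)) \<le> exp (\<epsilon> * \<bar>u\<bar>)" by simp
          also have "\<dots> \<le> exp (\<epsilon> * u) + exp (- \<epsilon> * u)" by (auto simp: abs_if)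
          finally have "q \<beta> u * exp (\<delta> * (u / z)) \<le> q \<beta> u * (exp (\<epsilon> * u) + exp (- \<epsilon> * u))"
            by (rule mult_left_mono[OF _ q_nonneg])
          also have "\<dots> = q (\<beta> + \<epsilon>) u + q (\<beta> - \<epsilon>) u"
            by (simp add: q_def vg_kernel_def algebra_simps exp_add exp_diff exp_minus divide_inverse)
          finally have exp_le: "q \<beta> u * exp (\<delta> * (u / z)) \<le> q (\<beta> + \<epsilon>) u + q (\<beta> - \<epsilon>) u" .
          have "\<bar>u\<bar> * (\<psi> (u / z) / \<phi> z) \<le> \<bar>u\<bar> * (C * (1 / \<bar>u\<bar> + \<bar>u\<bar>))"
            using elim False by (intro mult_left_mono) auto
          also have "\<dots> = C * (\<bar>u\<bar> powr 0 + \<bar>u\<bar> powr 2)"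
            using False by (simp add: field_simps power2_eq_square)
          finally have psi_le: "\<bar>u\<bar> * (\<psi> (u / z) / \<phi> z) \<le> C * (\<bar>u\<bar> powr 0 + \<bar>u\<bar> powr 2)" .
          have "(\<bar>u\<bar> * (\<psi> (u / z) / \<phi> z)) * (q \<beta> u * exp (\<delta> * (u / z)))
              \<le> C * (\<bar>u\<bar> powr 0 + \<bar>u\<bar> powr 2) * (q (\<beta> + \<epsilon>) u + q (\<beta> - \<epsilon>) u)"
            using elim nonneg[of "u / z"] q_nonneg[of \<beta> u] by (intro mult_mono'[OF psi_le exp_le]) auto
          moreover have "norm (?s z u) = (\<bar>u\<bar> * (\<psi> (u / z) / \<phi> z)) * (q \<beta> u * exp (\<delta> * (u / z)))"
            using elim nonneg[of "u / z"] q_nonneg[of \<beta> u] by (simp add: abs_mult)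
          ultimately show ?thesis by (simp add: mult.assoc)
        qed (simp add: q_0)
      qed
    qed
  qed auto
  also have "integral\<^sup>L lborel ?f = A * (LINT u|lborel. \<bar>u\<bar> powr (1 + r) * q \<beta> u)"
    by (rule integral_mult_right_zero)
  also have "(LINT u|lborel. \<bar>u\<bar> powr (1 + r) * q \<beta> u)
      = 2 powr (1 + r + m) * \<alpha> powr (- (1 + r + m + 1)) * Gamma ((1 + r + 1) / 2)
        * Gamma ((1 + r + 1) / 2 + m) * hyp2F1 ((1 + r + 1) / 2) ((1 + r + 1) / 2 + m) (1 / 2) (\<beta>\<^sup>2 / \<alpha>\<^sup>2)"
    unfolding q_def using m r \<beta> by (intro integral_moment_vg_kernel) auto
  also have "(1 + r + 1) / 2 = r / 2 + 1" by simp
  also have "1 + r + m + 1 = r + m + 2" by simp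
  finally show ?thesis
  proof (rule Lim_transform_eventually)
    show "\<forall>\<^sub>F z in at_top. integral\<^sup>L lborel (?s z)
        = z\<^sup>2 / \<phi> z * ratio_density (vg_kernel m \<alpha> \<beta>) (\<lambda>y. exp (\<delta> * y) * \<psi> y) z"
      using eventually_gt_at_top[of 0]
    proof eventually_elim
      case (elim z)
      have "integral\<^sup>L lborel (?s z)
          = (LINT u|lborel. (\<bar>u\<bar> * q \<beta> u * (exp (\<delta> * (u / z)) * \<psi> (u / z))) / \<phi> z)" by simp
      also have "\<dots> = z\<^sup>2 * ratio_density (q \<beta>) (\<lambda>y. exp (\<delta> * y) * \<psi> y) z / \<phi> z"
        unfolding ratio_density_scale[OF elim] by (rule integral_divide_zero)
      finally show ?case by (simp add: q_def)
    qed
  qed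
qed

lemma one_le_inverse_plus: "1 \<le> 1 / v + v" if "v > 0" for v :: real
  using that by (cases "v \<le> 1") (auto simp: add_increasing add_increasing2)

lemma powr_le_inverse_plus:
  fixes v r :: real
  assumes "v > 0" "- 1 \<le> r" "r \<le> 0"
  shows "v powr r \<le> 1 / v + v"
proof (cases "v \<le> 1")
  case True
  have "v powr r \<le> v powr - 1" using assms True by (intro powr_mono') auto
  also have "\<dots> = 1 / v" using assms by (simp add: powr_minus_divide)
  finally show ?thesis using assms by simp
next
  case False
  have "v powr r \<le> v powr 0" using assms False by (intro powr_mono) auto
  then show ?thesis using assms one_le_inverse_plus[of v] by simp
qed

text \<open>The exponent \<open>r = n - \<bar>n\<bar>\<close>, which is 0 or \<open>2 * n\<close>, is the order of
  \<open>\<bar>y\<bar> powr n * bessel_K n \<bar>y\<bar>\<close> at the origin.\<close>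

lemma tendsto_ratio_density_bessel_K:
  fixes m n \<alpha> \<beta> \<alpha>' \<delta> :: real
  assumes "m > - 1/2" "\<bar>\<beta>\<bar> < \<alpha>" "\<alpha>' > 0" "n > - 1/2" "n \<noteq> 0"
  defines "r \<equiv> n - \<bar>n\<bar>"
  shows "((\<lambda>z. z\<^sup>2 / z powr (- r) * ratio_density (vg_kernel m \<alpha> \<beta>) (vg_kernel n \<alpha>' \<delta>) z) \<longlongrightarrow>
      \<alpha>' powr (- \<bar>n\<bar>) * (2 powr (\<bar>n\<bar> - 1) * Gamma \<bar>n\<bar>)
      * (2 powr (1 + r + m) * \<alpha> powr (- (r + m + 2)) * Gamma (r / 2 + 1) * Gamma (r / 2 + 1 + m)
        * hyp2F1 (r / 2 + 1) (r / 2 + 1 + m) (1 / 2) (\<beta>\<^sup>2 / \<alpha>\<^sup>2))) at_top"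
proof -
  define \<psi> where "\<psi> = (\<lambda>y. \<bar>y\<bar> powr n * bessel_K n (\<alpha>' * \<bar>y\<bar>))"
  have r: "- 1 < r" "r \<le> 0" using assms by (auto simp: r_def)
  have K: "bessel_K n = bessel_K \<bar>n\<bar>" using bessel_K_minus[of n] by (auto simp: abs_if fun_eq_iff bessel_K_minus)
  \<comment> \<open>Writing \<open>n = r + |n|\<close> splits off the power |u|^r and leaves x^|n|
    K_|n|(x), which is bounded and has a positive limit at 0. The powers of \<open>z\<close> cancel
    exactly against \<open>z powr (- r)\<close>.\<close>
  have \<psi>_scaled: "\<psi> (u / z) / z powr (- r)
      = \<alpha>' powr (- \<bar>n\<bar>) * ((\<alpha>' * \<bar>u\<bar> / z) powr \<bar>n\<bar> * bessel_K \<bar>n\<bar> (\<alpha>' * \<bar>u\<bar> / z)) * \<bar>u\<bar> powr r"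
    if "u \<noteq> 0" "z > 0" for u z
  proof -
    have "n = r + \<bar>n\<bar>" by (simp add: r_def)
    then have "\<bar>u / z\<bar> powr n = \<bar>u\<bar> powr r / z powr r * (\<bar>u\<bar> / z) powr \<bar>n\<bar>"
      using that powr_add[of "\<bar>u / z\<bar>" r "\<bar>n\<bar>"] by (simp add: powr_divide)
    moreover have "(\<alpha>' * \<bar>u\<bar> / z) powr \<bar>n\<bar> = \<alpha>' powr \<bar>n\<bar> * (\<bar>u\<bar> / z) powr \<bar>n\<bar>"
      using that assms(3) by (simp add: powr_mult powr_divide)
    ultimately show ?thesis
      using that assms(3) by (simp add: \<psi>_def K powr_minus field_simps)
  qed
  have "((\<lambda>z. z\<^sup>2 / z powr (- r) * ratio_density (vg_kernel m \<alpha> \<beta>) (\<lambda>y. exp (\<delta> * y) * \<psi> y) z) \<longlongrightarrow>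
      \<alpha>' powr (- \<bar>n\<bar>) * (2 powr (\<bar>n\<bar> - 1) * Gamma \<bar>n\<bar>)
      * (2 powr (1 + r + m) * \<alpha> powr (- (r + m + 2)) * Gamma (r / 2 + 1) * Gamma (r / 2 + 1 + m)
        * hyp2F1 (r / 2 + 1) (r / 2 + 1 + m) (1 / 2) (\<beta>\<^sup>2 / \<alpha>\<^sup>2))) at_top"
  proof (rule tendsto_ratio_density_vg_kernel[OF assms(1,2) r(1)])
    show "\<psi> \<in> borel_measurable borel" unfolding \<psi>_def by measurable
    show "\<psi> y \<ge> 0" for y unfolding \<psi>_def by (auto intro: mult_nonneg_nonneg bessel_K_nonneg)
    show "\<forall>\<^sub>F z in at_top. z powr (- r) > (0::real)"
      by (intro eventually_mono[OF eventually_gt_at_top[of 0]]) auto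
    show "\<forall>\<^sub>F z in at_top. \<forall>u. u \<noteq> 0 \<longrightarrow> \<psi> (u / z) / z powr (- r)
        \<le> \<alpha>' powr (- \<bar>n\<bar>) * (2 powr (\<bar>n\<bar> - 1) * Gamma \<bar>n\<bar>) * (1 / \<bar>u\<bar> + \<bar>u\<bar>)"
      using eventually_gt_at_top[of 0]
    proof eventually_elim
      case (elim z)
      show ?case
      proof (intro allI impI)
        fix u :: real assume u: "u \<noteq> 0"
        have K_le: "(\<alpha>' * \<bar>u\<bar> / z) powr \<bar>n\<bar> * bessel_K \<bar>n\<bar> (\<alpha>' * \<bar>u\<bar> / z) \<le> 2 powr (\<bar>n\<bar> - 1) * Gamma \<bar>n\<bar>"
          using assms u elim by (intro powr_bessel_K_le) auto
        have u_le: "\<bar>u\<bar> powr r \<le> 1 / \<bar>u\<bar> + \<bar>u\<bar>" using u r by (intro powr_le_inverse_plus) auto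
        show "\<psi> (u / z) / z powr (- r)
            \<le> \<alpha>' powr (- \<bar>n\<bar>) * (2 powr (\<bar>n\<bar> - 1) * Gamma \<bar>n\<bar>) * (1 / \<bar>u\<bar> + \<bar>u\<bar>)"
          unfolding \<psi>_scaled[OF u elim] using assms
          by (intro mult_mono[OF mult_left_mono[OF K_le] u_le] mult_nonneg_nonneg
              less_imp_le[OF Gamma_real_pos]) auto
      qed
    qed
    fix u :: real assume u: "u \<noteq> 0"
    have "((\<lambda>z. \<alpha>' powr (- \<bar>n\<bar>) * ((\<alpha>' * \<bar>u\<bar> / z) powr \<bar>n\<bar> * bessel_K \<bar>n\<bar> (\<alpha>' * \<bar>u\<bar> / z)) * \<bar>u\<bar> powr r)
        \<longlongrightarrow> \<alpha>' powr (- \<bar>n\<bar>) * (2 powr (\<bar>n\<bar> - 1) * Gamma \<bar>n\<bar>) * \<bar>u\<bar> powr r) at_top"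
      using assms u by (intro tendsto_mult tendsto_const tendsto_powr_bessel_K) auto
    then show "((\<lambda>z. \<psi> (u / z) / z powr (- r))
        \<longlongrightarrow> \<alpha>' powr (- \<bar>n\<bar>) * (2 powr (\<bar>n\<bar> - 1) * Gamma \<bar>n\<bar>) * \<bar>u\<bar> powr r) at_top"
      by (rule Lim_transform_eventually)
         (use eventually_gt_at_top[of 0] in eventually_elim, simp add: \<psi>_scaled u)
  qed
  then show ?thesis by (simp add: \<psi>_def vg_kernel_def[abs_def] mult.assoc)
qed

text \<open>To leading order the logarithm of \<open>\<alpha>' * |u| / z\<close> does not feel
  \<open>u\<close>, so the general limit applies with \<open>r = 0\<close> and
  \<open>A = 1\<close>.\<close>

lemma tendsto_ratio_density_bessel_K_0:
  fixes m \<alpha> \<beta> \<alpha>' \<delta> :: real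
  assumes "m > - 1/2" "\<bar>\<beta>\<bar> < \<alpha>" "\<alpha>' > 0"
  shows "((\<lambda>z. z\<^sup>2 / ln z * ratio_density (vg_kernel m \<alpha> \<beta>) (vg_kernel 0 \<alpha>' \<delta>) z) \<longlongrightarrow>
      2 powr (1 + m) * \<alpha> powr (- (m + 2)) * Gamma (1 + m) * hyp2F1 1 (1 + m) (1 / 2) (\<beta>\<^sup>2 / \<alpha>\<^sup>2)) at_top"
proof -
  define \<psi> where "\<psi> = (\<lambda>y. \<bar>y\<bar> powr 0 * bessel_K 0 (\<alpha>' * \<bar>y\<bar>))"
  define C where "C = 3 + \<alpha>' + 1 / \<alpha>'"
  have "((\<lambda>z. z\<^sup>2 / ln z * ratio_density (vg_kernel m \<alpha> \<beta>) (\<lambda>y. exp (\<delta> * y) * \<psi> y) z) \<longlongrightarrow>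
      1 * (2 powr (1 + 0 + m) * \<alpha> powr (- (0 + m + 2)) * Gamma (0 / 2 + 1) * Gamma (0 / 2 + 1 + m)
        * hyp2F1 (0 / 2 + 1) (0 / 2 + 1 + m) (1 / 2) (\<beta>\<^sup>2 / \<alpha>\<^sup>2))) at_top"
  proof (rule tendsto_ratio_density_vg_kernel[OF assms(1,2)])
    show "(0::real) > - 1" by simp
    show "\<psi> \<in> borel_measurable borel" unfolding \<psi>_def by measurable
    show "\<psi> y \<ge> 0" for y unfolding \<psi>_def by (auto intro: mult_nonneg_nonneg bessel_K_nonneg)
    show "\<forall>\<^sub>F z in at_top. ln z > (0::real)"
      by (intro eventually_mono[OF eventually_gt_at_top[of 1]]) auto
    show "\<forall>\<^sub>F z in at_top. \<forall>u. u \<noteq> 0 \<longrightarrow> \<psi> (u / z) / ln z \<le> C * (1 / \<bar>u\<bar> + \<bar>u\<bar>)"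
      \<comment> \<open>\<open>z > exp 1\<close> gives \<open>ln z > 1\<close>, so additive
        constants may be multiplied by \<open>ln z\<close>. The 3 in \<open>C\<close> collects the
        coefficient of \<open>ln z\<close> and the 2 of the bound for K_0; the remainder of
        \<open>C\<close> covers \<open>1 / c\<close>, which bounds \<open>- ln c\<close>.\<close>
      using eventually_gt_at_top[of "exp 1"]
    proof eventually_elim
      case (elim z)
      then have z: "z > 0" "ln z > 1" using ln_less_cancel_iff[of "exp 1" z]
        by (auto intro: less_trans[OF exp_gt_zero])
      show ?case
      proof (intro allI impI)
        fix u :: real assume u: "u \<noteq> 0"
        define c where "c = \<alpha>' * \<bar>u\<bar>"
        have c: "c > 0" using assms u by (simp add: c_def)
        have "- ln c \<le> 1 / c" using c ln_le_minus_one[of "1 / c"] by (simp add: ln_div)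
        have "\<psi> (u / z) = bessel_K 0 (c / z)" using u z by (simp add: \<psi>_def c_def)
        also have "\<dots> \<le> max 0 (- ln (c / z)) + 2" using c z by (intro bessel_K_0_le) auto
        also have "\<dots> \<le> ln z + 1 / c + 2"
        proof -
          have "1 / c > 0" using c by simp
          then have "0 \<le> ln z + 1 / c" using z by linarith
          then show ?thesis using c z \<open>- ln c \<le> 1 / c\<close> by (simp add: ln_div)
        qed
        also have "\<dots> \<le> ln z * (3 + 1 / c)"
        proof -
          have "1 * (2 + 1 / c) \<le> ln z * (2 + 1 / c)" using z c by (intro mult_right_mono) auto
          then show ?thesis by (simp add: algebra_simps)
        qed
        finally have "\<psi> (u / z) / ln z \<le> 3 + 1 / c" 
          by (subst pos_divide_le_eq) (use z in linarith, simp add: mult.commute)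
        also have "\<dots> \<le> 3 * (1 / \<bar>u\<bar> + \<bar>u\<bar>) + (\<alpha>' + 1 / \<alpha>') * (1 / \<bar>u\<bar> + \<bar>u\<bar>)"
        proof (intro add_mono)
          show "3 \<le> 3 * (1 / \<bar>u\<bar> + \<bar>u\<bar>)" using one_le_inverse_plus[of "\<bar>u\<bar>"] u by simp
          have "1 / c = 1 / \<alpha>' * (1 / \<bar>u\<bar>)" by (simp add: c_def)
          also have "\<dots> \<le> (\<alpha>' + 1 / \<alpha>') * (1 / \<bar>u\<bar> + \<bar>u\<bar>)" using assms by (intro mult_mono) auto
          finally show "1 / c \<le> (\<alpha>' + 1 / \<alpha>') * (1 / \<bar>u\<bar> + \<bar>u\<bar>)" .
        qed
        also have "\<dots> = C * (1 / \<bar>u\<bar> + \<bar>u\<bar>)" by (simp add: C_def distrib_right)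
        finally show "\<psi> (u / z) / ln z \<le> C * (1 / \<bar>u\<bar> + \<bar>u\<bar>)" .
      qed
    qed
    fix u :: real assume u: "u \<noteq> 0"
    have "((\<lambda>z. bessel_K 0 (\<alpha>' * \<bar>u\<bar> / z) / ln z) \<longlongrightarrow> 1) at_top"
      using assms u by (intro tendsto_bessel_K_0_over_ln) auto
    then have "((\<lambda>z. \<psi> (u / z) / ln z) \<longlongrightarrow> 1) at_top"
      by (rule Lim_transform_eventually)
         (use eventually_gt_at_top[of 0] in eventually_elim, simp add: \<psi>_def u)
    then show "((\<lambda>z. \<psi> (u / z) / ln z) \<longlongrightarrow> 1 * \<bar>u\<bar> powr 0) at_top"
      using u by simp
  qed
  then show ?thesis by (simp add: \<psi>_def vg_kernel_def[abs_def] mult.assoc)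
qed

text \<open>On the reals \<open>at_infinity\<close> is the join of \<open>at_top\<close> and
  \<open>at_bot\<close>, so one limit along each half line suffices. Both must be the same
  \<open>L\<close> because the comparison function is even.\<close>

lemma asymp_equiv_at_infinity_realI:
  fixes F \<phi> :: "real \<Rightarrow> real"
  assumes "((\<lambda>z. z\<^sup>2 / \<phi> z * F z) \<longlongrightarrow> L) at_top" and "((\<lambda>z. z\<^sup>2 / \<phi> z * F (- z)) \<longlongrightarrow> L) at_top"
    and "L \<noteq> 0"
  shows "F \<sim>[at_infinity] (\<lambda>z. L * (\<phi> \<bar>z\<bar> / z\<^sup>2))"
proof (rule asymp_equivI')
  have quotient: "((\<lambda>z. G z / (L * (\<phi> \<bar>z\<bar> / z\<^sup>2))) \<longlongrightarrow> 1) at_top"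
    if "((\<lambda>z. z\<^sup>2 / \<phi> z * G z) \<longlongrightarrow> L) at_top" for G
  proof -
    have "((\<lambda>z. z\<^sup>2 / \<phi> z * G z / L) \<longlongrightarrow> L / L) at_top"
      by (intro tendsto_divide that tendsto_const assms(3))
    moreover have "\<forall>\<^sub>F z in at_top. z\<^sup>2 / \<phi> z * G z / L = G z / (L * (\<phi> \<bar>z\<bar> / z\<^sup>2))"
      using eventually_gt_at_top[of 0] by eventually_elim (simp add: mult_ac)
    ultimately show ?thesis using assms(3) by (simp add: tendsto_cong)
  qed
  have "((\<lambda>z. F z / (L * (\<phi> \<bar>z\<bar> / z\<^sup>2))) \<longlongrightarrow> 1) at_bot"
    unfolding at_bot_mirror filterlim_filtermap using quotient[OF assms(2)] by simp
  with quotient[OF assms(1)] show "((\<lambda>z. F z / (L * (\<phi> \<bar>z\<bar> / z\<^sup>2))) \<longlongrightarrow> 1) at_infinity"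
    unfolding at_infinity_eq_at_top_bot by (rule filterlim_sup)
qed

section \<open>Variance-gamma densities\<close>

definition vg_const :: "real \<Rightarrow> real \<Rightarrow> real \<Rightarrow> real" where
  "vg_const m \<alpha> \<beta> = vg_gamma \<alpha> \<beta> powr (2 * m + 1) / (sqrt pi * (2 * \<alpha>) powr m * Gamma (m + 1/2))"

lemma vg_density_conv_kernel: "vg_density m \<alpha> \<beta> x = vg_const m \<alpha> \<beta> * vg_kernel m \<alpha> \<beta> x"
  by (simp add: vg_density_def vg_const_def vg_kernel_def)

lemma vg_const_pos:
  assumes "m > - 1/2" "\<bar>\<beta>\<bar> < \<alpha>"
  shows "vg_const m \<alpha> \<beta> > 0"
proof -
  have "\<beta>\<^sup>2 < \<alpha>\<^sup>2" using power_strict_mono[OF assms(2), of 2] by simp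
  moreover have "\<alpha> > 0" using assms by linarith
  ultimately show ?thesis
    using assms unfolding vg_const_def vg_gamma_def
    by (intro divide_pos_pos mult_pos_pos Gamma_real_pos) auto
qed

lemma ratio_density_vg:
  "ratio_density (vg_density m \<alpha> \<beta>) (vg_density n \<alpha>' \<beta>') z
   = vg_const m \<alpha> \<beta> * vg_const n \<alpha>' \<beta>' * ratio_density (vg_kernel m \<alpha> \<beta>) (vg_kernel n \<alpha>' \<beta>') z"
proof -
  have "ratio_density (vg_density m \<alpha> \<beta>) (vg_density n \<alpha>' \<beta>') z
      = (LINT y|lborel. (vg_const m \<alpha> \<beta> * vg_const n \<alpha>' \<beta>')
          * (\<bar>y\<bar> * vg_kernel m \<alpha> \<beta> (y * z) * vg_kernel n \<alpha>' \<beta>' y))"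
    by (simp add: ratio_density_def vg_density_conv_kernel mult_ac)
  then show ?thesis by (simp only: ratio_density_def integral_mult_right_zero)
qed

lemma ratio_density_vg_kernel_uminus:
  "ratio_density (vg_kernel m \<alpha> \<beta>) g (- z) = ratio_density (vg_kernel m \<alpha> (- \<beta>)) g z"
  by (simp add: ratio_density_def vg_kernel_uminus)

text \<open>The limit is demanded for every \<open>b\<close> with
  \<open>b\<^sup>2 = \<beta>\<^sup>2\<close>, that is for both signs: \<open>\<beta>\<close> serves
  \<open>z\<close> near plus infinity and \<open>- \<beta>\<close> serves minus infinity. A common
  \<open>L\<close> can exist because the moments depend on \<beta> only through its square.\<close>

lemma asymp_equiv_ratio_density_vg:
  assumes "m > - 1/2" "\<bar>\<beta>\<bar> < \<alpha>" "n > - 1/2" "\<bar>\<beta>'\<bar> < \<alpha>'" "L \<noteq> 0"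
    and lim: "\<And>b. b\<^sup>2 = \<beta>\<^sup>2 \<Longrightarrow> \<bar>b\<bar> < \<alpha> \<Longrightarrow>
      ((\<lambda>z. z\<^sup>2 / \<phi> z * ratio_density (vg_kernel m \<alpha> b) (vg_kernel n \<alpha>' \<beta>') z) \<longlongrightarrow> L) at_top"
  shows "ratio_density (vg_density m \<alpha> \<beta>) (vg_density n \<alpha>' \<beta>')
    \<sim>[at_infinity] (\<lambda>z. vg_const m \<alpha> \<beta> * vg_const n \<alpha>' \<beta>' * L * (\<phi> \<bar>z\<bar> / z\<^sup>2))"
proof (rule asymp_equiv_at_infinity_realI)
  let ?c = "vg_const m \<alpha> \<beta> * vg_const n \<alpha>' \<beta>'"
  have lim': "((\<lambda>z. z\<^sup>2 / \<phi> z * (?c * ratio_density (vg_kernel m \<alpha> b) (vg_kernel n \<alpha>' \<beta>') z)) \<longlongrightarrow> ?c * L) at_top"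
    if "b\<^sup>2 = \<beta>\<^sup>2" "\<bar>b\<bar> < \<alpha>" for b
    using tendsto_mult[OF tendsto_const[of ?c] lim[OF that]] by (simp add: mult_ac)
  show "((\<lambda>z. z\<^sup>2 / \<phi> z * ratio_density (vg_density m \<alpha> \<beta>) (vg_density n \<alpha>' \<beta>') z) \<longlongrightarrow> ?c * L) at_top"
    unfolding ratio_density_vg using assms by (intro lim') auto
  show "((\<lambda>z. z\<^sup>2 / \<phi> z * ratio_density (vg_density m \<alpha> \<beta>) (vg_density n \<alpha>' \<beta>') (- z)) \<longlongrightarrow> ?c * L) at_top"
    unfolding ratio_density_vg ratio_density_vg_kernel_uminus using assms by (intro lim') auto
  show "?c * L \<noteq> 0" using vg_const_pos[of m \<beta> \<alpha>] vg_const_pos[of n \<beta>' \<alpha>'] assms by simp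
qed

section \<open>Powers of 2 and of the scale parameters in the leading constants\<close>

lemma vg_const_mult_numerator:
  assumes "\<alpha> > 0"
  shows "vg_const m \<alpha> \<beta> * (2 powr (1 + r + m) * \<alpha> powr (- (r + m + 2)))
    = vg_gamma \<alpha> \<beta> powr (2 * m + 1) / (sqrt pi * Gamma (m + 1/2))
      * (2 powr (1 + r) / \<alpha> powr (r + 2 * m + 2))"
proof -
  have "2 powr (1 + r + m) = 2 powr (1 + r) * 2 powr m"
    by (rule powr_add)
  moreover have "\<alpha> powr (- (r + m + 2)) = \<alpha> powr m / \<alpha> powr (r + 2 * m + 2)"
    by (subst powr_diff[symmetric]) (simp add: algebra_simps)
  ultimately show ?thesis
    using assms by (simp add: vg_const_def powr_mult)
qed

text \<open>Here \<open>p\<close> stands for |n|. For p = n the power of 2 is 1/2 and \<alpha> gets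
  the exponent 2n; for p = -n the power of \<alpha> is 1, which is why \<alpha>2 is absent from the
  result for negative n.\<close>

lemma vg_const_mult_denominator:
  assumes "\<alpha> > 0"
  shows "vg_const n \<alpha> \<beta> * (\<alpha> powr (- p) * 2 powr (p - 1))
    = vg_gamma \<alpha> \<beta> powr (2 * n + 1) / (sqrt pi * Gamma (n + 1/2))
      * (2 powr (p - n - 1) / \<alpha> powr (n + p))"
proof -
  have "2 powr (p - 1) = 2 powr (p - n - 1) * (2 powr n :: real)"
    by (simp flip: powr_add)
  moreover have "\<alpha> powr (- p) = \<alpha> powr n / \<alpha> powr (n + p)"
    by (simp flip: powr_diff)
  ultimately show ?thesis
    using assms by (simp add: vg_const_def powr_mult)
qed

text \<open>The complex identity carries over without exceptions: at integers both sides are 0,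
  since Gamma is 0 at its poles and division by 0 gives 0.\<close>

lemma Gamma_reflection_real: "Gamma x * Gamma (1 - x) = pi / sin (pi * x)" for x :: real
proof -
  have "complex_of_real (Gamma x * Gamma (1 - x)) = complex_of_real (pi / sin (pi * x))"
    using Gamma_reflection_complex[of "complex_of_real x"]
    by (simp flip: Gamma_complex_of_real sin_of_real)
  then show ?thesis by (simp only: of_real_eq_iff)
qed

theorem proposition2p8:
  fixes M :: "'a measure" and X Y :: "'a \<Rightarrow> real" and fZ :: "real \<Rightarrow> real"
    and m n \<alpha>1 \<beta>1 \<alpha>2 \<beta>2 \<gamma>1 \<gamma>2 :: real
  assumes "prob_space M"
    and "m > - 1/2" and "n > - 1/2"
    and "\<bar>\<beta>1\<bar> < \<alpha>1" and "\<bar>\<beta>2\<bar> < \<alpha>2"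
    and "\<gamma>1 = vg_gamma \<alpha>1 \<beta>1" and "\<gamma>2 = vg_gamma \<alpha>2 \<beta>2"
    and "VG_distributed M X m \<alpha>1 \<beta>1" and "VG_distributed M Y n \<alpha>2 \<beta>2"
    and "prob_space.indep_var M borel X borel Y"
    and "distributed M lborel (\<lambda>\<omega>. X \<omega> / Y \<omega>) (\<lambda>z. ennreal (fZ z))"
    and "\<And>z. fZ z = ratio_density (vg_density m \<alpha>1 \<beta>1) (vg_density n \<alpha>2 \<beta>2) z"
  shows "(n > 0 \<longrightarrow>
      fZ \<sim>[at_infinity] (\<lambda>z.
        \<gamma>1 powr (2*m+1) * \<gamma>2 powr (2*n+1) / (pi * \<alpha>1 powr (2*m+2) * \<alpha>2 powr (2*n))
        * (Gamma (m+1) * Gamma n * (1 / z\<^sup>2) / (Gamma (m + 1/2) * Gamma (n + 1/2)))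
        * hyp2F1 1 (m+1) (1/2) (\<beta>1\<^sup>2 / \<alpha>1\<^sup>2)))
    \<and> (n = 0 \<longrightarrow>
      fZ \<sim>[at_infinity] (\<lambda>z.
        2 * \<gamma>1 powr (2*m+1) * \<gamma>2 / (pi powr (3/2) * \<alpha>1 powr (2*m+2))
        * (Gamma (m+1) * (1 / z\<^sup>2) * ln \<bar>z\<bar> / Gamma (m + 1/2))
        * hyp2F1 1 (m+1) (1/2) (\<beta>1\<^sup>2 / \<alpha>1\<^sup>2)))
    \<and> (- 1/2 < n \<and> n < 0 \<longrightarrow>
      fZ \<sim>[at_infinity] (\<lambda>z.
        \<gamma>1 powr (2*m+1) * \<gamma>2 powr (2*n+1) / (\<alpha>1 powr (2*m+2*n+2) * sin (- n * pi))
        * (Gamma (m+n+1) * \<bar>z\<bar> powr (-2-2*n) / (Gamma (m + 1/2) * Gamma (n + 1/2)))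
        * hyp2F1 (n+1) (m+n+1) (1/2) (\<beta>1\<^sup>2 / \<alpha>1\<^sup>2)))"
proof (intro conjI impI)
  have \<alpha>: "\<alpha>1 > 0" "\<alpha>2 > 0" using assms(4,5) by linarith+
  have fZ: "fZ = ratio_density (vg_density m \<alpha>1 \<beta>1) (vg_density n \<alpha>2 \<beta>2)"
    using assms(12) by blast
  have "\<beta>1\<^sup>2 < \<alpha>1\<^sup>2" using power_strict_mono[OF assms(4), of 2] by simp
  then have F_pos: "hyp2F1 a b (1/2) (\<beta>1\<^sup>2 / \<alpha>1\<^sup>2) > 0" if "a > 0" "b > 0" for a b
    using that \<alpha> by (intro hyp2F1_pos) (auto simp: divide_less_eq_1)
  note equiv = asymp_equiv_ratio_density_vg[OF assms(2,4,3,5)]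
  show "fZ \<sim>[at_infinity] (\<lambda>z.
      \<gamma>1 powr (2*m+1) * \<gamma>2 powr (2*n+1) / (pi * \<alpha>1 powr (2*m+2) * \<alpha>2 powr (2*n))
      * (Gamma (m+1) * Gamma n * (1 / z\<^sup>2) / (Gamma (m + 1/2) * Gamma (n + 1/2)))
      * hyp2F1 1 (m+1) (1/2) (\<beta>1\<^sup>2 / \<alpha>1\<^sup>2))" (is "_ \<sim>[_] ?g") if n: "n > 0"
  proof -
    let ?L = "\<alpha>2 powr (- n) * (2 powr (n - 1) * Gamma n)
      * (2 powr (1 + m) * \<alpha>1 powr (- (m + 2)) * Gamma (1 + m) * hyp2F1 1 (1 + m) (1 / 2) (\<beta>1\<^sup>2 / \<alpha>1\<^sup>2))"
    have "?L > 0"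
      using n assms(2) \<alpha> by (intro mult_pos_pos Gamma_real_pos F_pos) auto
    have "fZ \<sim>[at_infinity] (\<lambda>z. vg_const m \<alpha>1 \<beta>1 * vg_const n \<alpha>2 \<beta>2 * ?L * (\<bar>z\<bar> powr 0 / z\<^sup>2))"
      unfolding fZ
    proof (rule equiv)
      show "((\<lambda>z. z\<^sup>2 / z powr 0 * ratio_density (vg_kernel m \<alpha>1 b) (vg_kernel n \<alpha>2 \<beta>2) z) \<longlongrightarrow> ?L) at_top"
        if "b\<^sup>2 = \<beta>1\<^sup>2" "\<bar>b\<bar> < \<alpha>1" for b
        using tendsto_ratio_density_bessel_K[OF assms(2) that(2) \<alpha>(2) assms(3), of \<beta>2] n that(1) by simp
    qed (rule less_imp_neq[OF \<open>?L > 0\<close>, THEN not_sym])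
    also have "(\<lambda>z. vg_const m \<alpha>1 \<beta>1 * vg_const n \<alpha>2 \<beta>2 * ?L * (\<bar>z\<bar> powr 0 / z\<^sup>2)) = ?g"
    proof
      fix z :: real
      have "vg_const m \<alpha>1 \<beta>1 * vg_const n \<alpha>2 \<beta>2 * ?L
          = \<gamma>1 powr (2*m+1) * \<gamma>2 powr (2*n+1) / (pi * \<alpha>1 powr (2*m+2) * \<alpha>2 powr (2*n))
            * (Gamma (m+1) * Gamma n / (Gamma (m + 1/2) * Gamma (n + 1/2)))
            * hyp2F1 1 (m+1) (1/2) (\<beta>1\<^sup>2 / \<alpha>1\<^sup>2)"
      proof -
        have "vg_const m \<alpha>1 \<beta>1 * vg_const n \<alpha>2 \<beta>2 * ?L
          = (vg_const m \<alpha>1 \<beta>1 * (2 powr (1 + 0 + m) * \<alpha>1 powr (- (0 + m + 2))))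
            * (vg_const n \<alpha>2 \<beta>2 * (\<alpha>2 powr (- n) * 2 powr (n - 1)))
            * (Gamma (m+1) * Gamma n * hyp2F1 1 (m+1) (1/2) (\<beta>1\<^sup>2 / \<alpha>1\<^sup>2))"
          by (simp add: mult_ac add.commute)
        \<comment> \<open>The factor 2 contributed by X cancels against the 1/2 contributed by Y,
          and the two \<open>sqrt pi\<close> combine to pi.\<close>
        also have "\<dots> = \<gamma>1 powr (2*m+1) / (sqrt pi * Gamma (m + 1/2)) * (2 / \<alpha>1 powr (2*m+2))
            * (\<gamma>2 powr (2*n+1) / (sqrt pi * Gamma (n + 1/2)) * (1 / 2 / \<alpha>2 powr (2*n)))
            * (Gamma (m+1) * Gamma n * hyp2F1 1 (m+1) (1/2) (\<beta>1\<^sup>2 / \<alpha>1\<^sup>2))"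
          unfolding vg_const_mult_numerator[OF \<alpha>(1)] vg_const_mult_denominator[OF \<alpha>(2)] assms(6,7)
            mult_2[of n, symmetric] by (simp add: powr_neg_one)
        also have "\<dots> = \<gamma>1 powr (2*m+1) * \<gamma>2 powr (2*n+1)
              / (sqrt pi * sqrt pi * \<alpha>1 powr (2*m+2) * \<alpha>2 powr (2*n))
            * (Gamma (m+1) * Gamma n / (Gamma (m + 1/2) * Gamma (n + 1/2)))
            * hyp2F1 1 (m+1) (1/2) (\<beta>1\<^sup>2 / \<alpha>1\<^sup>2)"
          by (simp only: times_divide_eq_left times_divide_eq_right divide_divide_eq_left) (simp add: mult_ac)
        finally show ?thesis by simp
      qed
      \<comment> \<open>The two functions agree everywhere; at \<open>z = 0\<close> both vanish by
        division by 0.\<close>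
      then show "vg_const m \<alpha>1 \<beta>1 * vg_const n \<alpha>2 \<beta>2 * ?L * (\<bar>z\<bar> powr 0 / z\<^sup>2) = ?g z"
        by (cases "z = 0") simp_all
    qed
    finally show ?thesis .
  qed
  show "fZ \<sim>[at_infinity] (\<lambda>z.
      2 * \<gamma>1 powr (2*m+1) * \<gamma>2 / (pi powr (3/2) * \<alpha>1 powr (2*m+2))
      * (Gamma (m+1) * (1 / z\<^sup>2) * ln \<bar>z\<bar> / Gamma (m + 1/2))
      * hyp2F1 1 (m+1) (1/2) (\<beta>1\<^sup>2 / \<alpha>1\<^sup>2))" (is "_ \<sim>[_] ?g") if n: "n = 0"
  proof -
    let ?L = "2 powr (1 + m) * \<alpha>1 powr (- (m + 2)) * Gamma (1 + m) * hyp2F1 1 (1 + m) (1 / 2) (\<beta>1\<^sup>2 / \<alpha>1\<^sup>2)"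
    have "?L > 0"
      using assms(2) \<alpha> by (intro mult_pos_pos Gamma_real_pos F_pos) auto
    have "fZ \<sim>[at_infinity] (\<lambda>z. vg_const m \<alpha>1 \<beta>1 * vg_const n \<alpha>2 \<beta>2 * ?L * (ln \<bar>z\<bar> / z\<^sup>2))"
      unfolding fZ
    proof (rule equiv)
      show "((\<lambda>z. z\<^sup>2 / ln z * ratio_density (vg_kernel m \<alpha>1 b) (vg_kernel n \<alpha>2 \<beta>2) z) \<longlongrightarrow> ?L) at_top"
        if "b\<^sup>2 = \<beta>1\<^sup>2" "\<bar>b\<bar> < \<alpha>1" for b
        using tendsto_ratio_density_bessel_K_0[OF assms(2) that(2) \<alpha>(2), of \<beta>2] n that(1) by simp
    qed (rule less_imp_neq[OF \<open>?L > 0\<close>, THEN not_sym])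
    also have "(\<lambda>z. vg_const m \<alpha>1 \<beta>1 * vg_const n \<alpha>2 \<beta>2 * ?L * (ln \<bar>z\<bar> / z\<^sup>2)) = ?g"
    proof
      fix z :: real
      have "\<beta>2\<^sup>2 < \<alpha>2\<^sup>2" using power_strict_mono[OF assms(5), of 2] by simp
      then have "\<gamma>2 > 0" by (simp add: assms(7) vg_gamma_def)
      then have "\<gamma>2 powr (2*n+1) = \<gamma>2" by (simp add: n)
      have "pi powr (3/2) = pi * sqrt pi"
        using powr_add[of pi 1 "1/2"] by (simp add: powr_half_sqrt)
      have "vg_const m \<alpha>1 \<beta>1 * vg_const n \<alpha>2 \<beta>2 * ?L
          = 2 * \<gamma>1 powr (2*m+1) * \<gamma>2 / (pi powr (3/2) * \<alpha>1 powr (2*m+2))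
            * (Gamma (m+1) / Gamma (m + 1/2)) * hyp2F1 1 (m+1) (1/2) (\<beta>1\<^sup>2 / \<alpha>1\<^sup>2)"
      proof -
        have split: "vg_const m \<alpha>1 \<beta>1 * vg_const n \<alpha>2 \<beta>2 * ?L
          = (vg_const m \<alpha>1 \<beta>1 * (2 powr (1 + 0 + m) * \<alpha>1 powr (- (0 + m + 2))))
            * vg_const n \<alpha>2 \<beta>2 * (Gamma (m+1) * hyp2F1 1 (m+1) (1/2) (\<beta>1\<^sup>2 / \<alpha>1\<^sup>2))"
          by (simp add: mult_ac add.commute)
        \<comment> \<open>\<open>sqrt pi * Gamma (1/2)\<close> equals pi; with the
          \<open>sqrt pi\<close> from the density of X it becomes
          \<open>pi powr (3/2)\<close>.\<close>
        have const_n: "vg_const n \<alpha>2 \<beta>2 = \<gamma>2 / pi"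
          using \<open>\<gamma>2 powr (2*n+1) = \<gamma>2\<close> \<alpha> n
          by (simp add: vg_const_def Gamma_one_half_real flip: assms(7))
        have const_m: "(vg_const m \<alpha>1 \<beta>1 * (2 powr (1 + 0 + m) * \<alpha>1 powr (- (0 + m + 2))))
          = \<gamma>1 powr (2*m+1) / (sqrt pi * Gamma (m + 1/2)) * (2 / \<alpha>1 powr (2*m+2))"
          unfolding vg_const_mult_numerator[OF \<alpha>(1)] assms(6) by simp
        show ?thesis
          unfolding split unfolding const_m const_n \<open>pi powr (3/2) = pi * sqrt pi\<close> by (simp add: mult_ac)
      qed
      then show "vg_const m \<alpha>1 \<beta>1 * vg_const n \<alpha>2 \<beta>2 * ?L * (ln \<bar>z\<bar> / z\<^sup>2) = ?g z"
        by simp (simp add: mult_ac)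
    qed
    finally show ?thesis .
  qed
  show "fZ \<sim>[at_infinity] (\<lambda>z.
      \<gamma>1 powr (2*m+1) * \<gamma>2 powr (2*n+1) / (\<alpha>1 powr (2*m+2*n+2) * sin (- n * pi))
      * (Gamma (m+n+1) * \<bar>z\<bar> powr (-2-2*n) / (Gamma (m + 1/2) * Gamma (n + 1/2)))
      * hyp2F1 (n+1) (m+n+1) (1/2) (\<beta>1\<^sup>2 / \<alpha>1\<^sup>2))" (is "_ \<sim>[_] ?g") if "- 1/2 < n \<and> n < 0"
  proof -
    have n: "n < 0" "- n > 0" using that by auto
    \<comment> \<open>Now \<open>|n| = - n\<close> and \<open>r = 2 * n\<close>, so the moment of X
      has order \<open>1 + 2 * n\<close> and the upper parameters are \<open>n + 1\<close> and
      \<open>n + 1 + m\<close>. The latter is positive because \<open>m\<close> and \<open>n\<close>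
      both exceed -1/2.\<close>
    let ?L = "\<alpha>2 powr n * (2 powr (- n - 1) * Gamma (- n))
      * (2 powr (1 + 2 * n + m) * \<alpha>1 powr (- (2 * n + m + 2)) * Gamma (n + 1) * Gamma (n + 1 + m)
          * hyp2F1 (n + 1) (n + 1 + m) (1 / 2) (\<beta>1\<^sup>2 / \<alpha>1\<^sup>2))"
    have "?L > 0"
      using n assms(2,3) \<alpha> by (intro mult_pos_pos Gamma_real_pos F_pos) auto
    have "fZ \<sim>[at_infinity]
        (\<lambda>z. vg_const m \<alpha>1 \<beta>1 * vg_const n \<alpha>2 \<beta>2 * ?L * (\<bar>z\<bar> powr (- (2 * n)) / z\<^sup>2))"
      unfolding fZ
    proof (rule equiv)
      have "n - \<bar>n\<bar> = 2 * n" using n by simp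
      then show "((\<lambda>z. z\<^sup>2 / z powr (- (2 * n)) * ratio_density (vg_kernel m \<alpha>1 b) (vg_kernel n \<alpha>2 \<beta>2) z)
          \<longlongrightarrow> ?L) at_top"
        if "b\<^sup>2 = \<beta>1\<^sup>2" "\<bar>b\<bar> < \<alpha>1" for b
        using tendsto_ratio_density_bessel_K[OF assms(2) that(2) \<alpha>(2) assms(3), of \<beta>2] n that(1) by simp
    qed (rule less_imp_neq[OF \<open>?L > 0\<close>, THEN not_sym])
    also have "(\<lambda>z. vg_const m \<alpha>1 \<beta>1 * vg_const n \<alpha>2 \<beta>2 * ?L * (\<bar>z\<bar> powr (- (2 * n)) / z\<^sup>2)) = ?g"
    proof
      fix z :: real
      \<comment> \<open>\<open>Gamma (- n)\<close> comes from the Bessel function at the origin and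
        \<open>Gamma (n + 1)\<close> from the moment of X. Their product yields the sine and a pi
        that cancels the one from the normalizing constants.\<close>
      have reflection: "Gamma (- n) * Gamma (n + 1) = pi / sin (- n * pi)"
        using Gamma_reflection_real[of "- n"] by (simp add: add.commute mult.commute)
      have "vg_const m \<alpha>1 \<beta>1 * vg_const n \<alpha>2 \<beta>2 * ?L
          = \<gamma>1 powr (2*m+1) * \<gamma>2 powr (2*n+1) / (pi * \<alpha>1 powr (2*m+2*n+2)) * (Gamma (- n) * Gamma (n + 1))
            * (Gamma (m+n+1) / (Gamma (m + 1/2) * Gamma (n + 1/2)))
            * hyp2F1 (n+1) (m+n+1) (1/2) (\<beta>1\<^sup>2 / \<alpha>1\<^sup>2)"
      proof -
        have "vg_const m \<alpha>1 \<beta>1 * vg_const n \<alpha>2 \<beta>2 * ?L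
          = (vg_const m \<alpha>1 \<beta>1 * (2 powr (1 + 2 * n + m) * \<alpha>1 powr (- (2 * n + m + 2))))
            * (vg_const n \<alpha>2 \<beta>2 * (\<alpha>2 powr (- (- n)) * 2 powr (- n - 1)))
            * (Gamma (- n) * Gamma (n+1) * Gamma (m+n+1) * hyp2F1 (n+1) (m+n+1) (1/2) (\<beta>1\<^sup>2 / \<alpha>1\<^sup>2))"
          by (simp add: mult_ac add_ac)
        also have "\<dots> = \<gamma>1 powr (2*m+1) / (sqrt pi * Gamma (m + 1/2)) * (2 powr (1+2*n) / \<alpha>1 powr (2*m+2*n+2))
            * (\<gamma>2 powr (2*n+1) / (sqrt pi * Gamma (n + 1/2)) * 2 powr (- (1+2*n)))
            * (Gamma (- n) * Gamma (n+1) * Gamma (m+n+1) * hyp2F1 (n+1) (m+n+1) (1/2) (\<beta>1\<^sup>2 / \<alpha>1\<^sup>2))"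
        proof -
          have exponents: "- n - n - 1 = - (1 + 2 * n)" "2 * n + 2 * m + 2 = 2 * m + 2 * n + 2" "n + - n = 0"
            by simp_all
          show ?thesis
            unfolding vg_const_mult_numerator[OF \<alpha>(1)] vg_const_mult_denominator[OF \<alpha>(2)] assms(6,7)
              exponents using \<alpha> by simp
        qed
        also have "\<dots> = (2 powr (1+2*n) * 2 powr (- (1+2*n)))
            * (\<gamma>1 powr (2*m+1) * \<gamma>2 powr (2*n+1) / (sqrt pi * sqrt pi * \<alpha>1 powr (2*m+2*n+2))
              * (Gamma (- n) * Gamma (n + 1))
            * (Gamma (m+n+1) / (Gamma (m + 1/2) * Gamma (n + 1/2)))
            * hyp2F1 (n+1) (m+n+1) (1/2) (\<beta>1\<^sup>2 / \<alpha>1\<^sup>2))"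
          by (simp only: times_divide_eq_left times_divide_eq_right divide_divide_eq_left mult_ac)
        also have "2 powr (1+2*n) * 2 powr (- (1+2*n)) = (1 :: real)"
          by (simp flip: powr_add)
        finally show ?thesis by simp
      qed
      also have "\<dots> = \<gamma>1 powr (2*m+1) * \<gamma>2 powr (2*n+1) / (\<alpha>1 powr (2*m+2*n+2) * sin (- n * pi))
            * (Gamma (m+n+1) / (Gamma (m + 1/2) * Gamma (n + 1/2)))
            * hyp2F1 (n+1) (m+n+1) (1/2) (\<beta>1\<^sup>2 / \<alpha>1\<^sup>2)"
        unfolding reflection by simp
      finally have const: "vg_const m \<alpha>1 \<beta>1 * vg_const n \<alpha>2 \<beta>2 * ?L = \<dots>" .
      have "\<bar>z\<bar> powr (-2-2*n) = \<bar>z\<bar> powr (- (2 * n)) / z\<^sup>2"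
        by (cases "z = 0") (simp_all add: powr_diff powr_minus field_simps)
      with const show "vg_const m \<alpha>1 \<beta>1 * vg_const n \<alpha>2 \<beta>2 * ?L * (\<bar>z\<bar> powr (- (2 * n)) / z\<^sup>2) = ?g z"
        by simp (simp add: mult_ac)
    qed
    finally show ?thesis .
  qed
qed

end
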